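(* Let $0<\kappa<\frac14$ and let $u\in H^1_{loc}(\Omega)\cap C(\Omega)$ be an $\mathcal L_\kappa$-subharmonic function in $\Omega$ such that $$\limsup_{d(x)\to0}\frac{u(x)}{(d(x))^{\frac{\alpha_-}{2}}}\le0 .$$ Then $u\le0$ in $\Omega$.
   Context: $\Omega\subset\mathbb R^N$ ($N\ge2$) is a bounded convex domain with smooth boundary, $d(x)=\mathrm{dist}(x,\partial\Omega)$, $\mathcal L_\kappa u=-\Delta u-\frac{\kappa}{d^2(x)}u$, $\alpha_-=1-\sqrt{1-4\kappa}$. A function $u\in H^1_{loc}(\Omega)\cap C(\Omega)$ is $\mathcal L_\kappa$-subharmonic in $\Omega$ if $\int_\Omega\nabla u\cdot\nabla\psi\,dx-\kappa\int_\Omega d^{-2}u\psi\,dx\le0$ for all $\psi\in H^1(\Omega)$, $\psi\ge0$, with compact support in $\Omega$. *)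

theory Defs
  imports "HOL-Analysis.Analysis"
begin

primrec C_k :: "nat \<Rightarrow> ('a::euclidean_space \<Rightarrow> real) \<Rightarrow> bool" where
  "C_k 0 f \<longleftrightarrow> continuous_on UNIV f"
| "C_k (Suc k) f \<longleftrightarrow>
     (\<forall>x. f differentiable (at x)) \<and> (\<forall>i\<in>Basis. C_k k (\<lambda>x. frechet_derivative f (at x) i))"

definition smooth :: "('a::euclidean_space \<Rightarrow> real) \<Rightarrow> bool" where
  "smooth f \<longleftrightarrow> (\<forall>k. C_k k f)"

text \<open>Near each boundary point, \<open>\<Omega>\<close> is the part of a ball above a smooth graph in the direction of a
  unit vector \<open>e\<close>. The function \<open>\<gamma>\<close> is only evaluated on the hyperplane orthogonal to \<open>e\<close>; a smooth
  function there extends to the whole space by making it constant along \<open>e\<close>.\<close>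

definition smooth_boundary :: "'a::euclidean_space set \<Rightarrow> bool" where
  "smooth_boundary \<Omega> \<longleftrightarrow>
     (\<forall>p\<in>frontier \<Omega>. \<exists>r>0. \<exists>e \<gamma>. norm e = 1 \<and> smooth \<gamma> \<and>
        \<Omega> \<inter> ball p r = {x \<in> ball p r. x \<bullet> e > \<gamma> (x - (x \<bullet> e) *\<^sub>R e)})"

definition boundary_dist :: "'a::euclidean_space set \<Rightarrow> 'a \<Rightarrow> real" where
  "boundary_dist \<Omega> x = infdist x (frontier \<Omega>)"

definition test_functions :: "'a::euclidean_space set \<Rightarrow> ('a \<Rightarrow> real) set" where
  "test_functions \<Omega> =
     {\<phi>. smooth \<phi> \<and> compact (closure {x. \<phi> x \<noteq> 0}) \<and> closure {x. \<phi> x \<noteq> 0} \<subseteq> \<Omega>}"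

text \<open>Elements of the function spaces below are functions on the whole type, of which only the values
  on \<open>\<Omega>\<close> matter; they are not identified when equal almost everywhere.\<close>

definition L1_loc :: "'a::euclidean_space set \<Rightarrow> ('a \<Rightarrow> 'b::euclidean_space) set" where
  "L1_loc \<Omega> = {f. \<forall>K. compact K \<and> K \<subseteq> \<Omega> \<longrightarrow> set_integrable lebesgue K f}"

definition L2 :: "'a::euclidean_space set \<Rightarrow> ('a \<Rightarrow> 'b::euclidean_space) set" where
  "L2 S = {f. set_borel_measurable lebesgue S f \<and> set_integrable lebesgue S (\<lambda>x. (norm (f x))\<^sup>2)}"

definition L2_loc :: "'a::euclidean_space set \<Rightarrow> ('a \<Rightarrow> 'b::euclidean_space) set" where
  "L2_loc \<Omega> = {f. \<forall>K. compact K \<and> K \<subseteq> \<Omega> \<longrightarrow> f \<in> L2 K}"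

text \<open>For open \<open>\<Omega>\<close> the weak gradient is unique up to a null set, so it is treated as a relation.\<close>

definition has_weak_gradient ::
    "'a::euclidean_space set \<Rightarrow> ('a \<Rightarrow> real) \<Rightarrow> ('a \<Rightarrow> 'a) \<Rightarrow> bool" where
  "has_weak_gradient \<Omega> u g \<longleftrightarrow> u \<in> L1_loc \<Omega> \<and> g \<in> L1_loc \<Omega> \<and>
     (\<forall>\<phi>\<in>test_functions \<Omega>. \<forall>i\<in>Basis.
        (LINT x:\<Omega>|lebesgue. u x * frechet_derivative \<phi> (at x) i) =
        - (LINT x:\<Omega>|lebesgue. (g x \<bullet> i) * \<phi> x))"

definition H1 :: "'a::euclidean_space set \<Rightarrow> ('a \<Rightarrow> real) set" where
  "H1 \<Omega> = {u \<in> L2 \<Omega>. \<exists>g\<in>L2 \<Omega>. has_weak_gradient \<Omega> u g}"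

definition H1_loc :: "'a::euclidean_space set \<Rightarrow> ('a \<Rightarrow> real) set" where
  "H1_loc \<Omega> = {u \<in> L2_loc \<Omega>. \<exists>g\<in>L2_loc \<Omega>. has_weak_gradient \<Omega> u g}"

text \<open>Sign and support of \<open>\<psi> \<in> H1 \<Omega>\<close> are understood almost everywhere.\<close>

definition L_subharmonic :: "real \<Rightarrow> 'a::euclidean_space set \<Rightarrow> ('a \<Rightarrow> real) \<Rightarrow> bool" where
  "L_subharmonic \<kappa> \<Omega> u \<longleftrightarrow> u \<in> H1_loc \<Omega> \<and> continuous_on \<Omega> u \<and>
     (\<forall>\<psi>\<in>H1 \<Omega>. \<forall>Du D\<psi>.
        (AE x in lebesgue. x \<in> \<Omega> \<longrightarrow> \<psi> x \<ge> 0) \<and>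
        (\<exists>K. compact K \<and> K \<subseteq> \<Omega> \<and> (AE x in lebesgue. x \<in> \<Omega> - K \<longrightarrow> \<psi> x = 0)) \<and>
        has_weak_gradient \<Omega> u Du \<and> has_weak_gradient \<Omega> \<psi> D\<psi> \<longrightarrow>
        (LINT x:\<Omega>|lebesgue. Du x \<bullet> D\<psi> x)
          - \<kappa> * (LINT x:\<Omega>|lebesgue. u x * \<psi> x / (boundary_dist \<Omega> x)\<^sup>2) \<le> 0)"

definition alpha_minus :: "real \<Rightarrow> real" where
  "alpha_minus \<kappa> = 1 - sqrt (1 - 4 * \<kappa>)"

definition to_boundary :: "'a::euclidean_space set \<Rightarrow> 'a filter" where
  "to_boundary \<Omega> = inf (filtercomap (boundary_dist \<Omega>) (at_right 0)) (principal \<Omega>)"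

end

theory Submission
  imports Defs
begin

text \<open>With \<open>\<beta> = \<alpha>\<^sub>- / 2\<close>, so that \<open>\<beta> (1 - \<beta>) = \<kappa>\<close>, the function \<open>v = d\<^sup>\<beta> + d\<^sup>1\<^sup>/\<^sup>2\<close> is a strict supersolution, because
  \<open>\<kappa> < 1/4\<close> and \<open>d\<close> is concave. If \<open>u\<close> is positive somewhere, the boundary condition forces \<open>u / v\<close> to attain a
  positive maximum \<open>c\<close> at some \<open>x0 \<in> \<Omega>\<close>. A supporting hyperplane at the boundary point nearest to \<open>x0\<close>
  gives an affine \<open>l \<ge> d\<close> with \<open>l x0 = d x0\<close>, so the function \<open>c (l\<^sup>\<beta> + l\<^sup>1\<^sup>/\<^sup>2)\<close>, smooth near \<open>x0\<close>, touches \<open>u\<close>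
  from above at \<open>x0\<close>. A continuous distributional subsolution is a viscosity subsolution, and
  the resulting inequality at \<open>x0\<close> contradicts strictness. Neither Hardy's inequality nor the chain
  rule for Sobolev functions is needed.\<close>

subsection \<open>Smooth functions and a bump function\<close>

text \<open>The argument order makes \<open>partial i\<close> an operator on functions that can be
  iterated. The direction may be any vector, so at a point of differentiability
  \<open>\<lambda>h. partial h f x\<close> is the full derivative.\<close>

definition partial :: "'a \<Rightarrow> ('a::euclidean_space \<Rightarrow> real) \<Rightarrow> 'a \<Rightarrow> real" where
  "partial i f x = frechet_derivative f (at x) i"

definition laplacian :: "('a::euclidean_space \<Rightarrow> real) \<Rightarrow> 'a \<Rightarrow> real" where
  "laplacian f x = (\<Sum>i\<in>Basis. partial i (partial i f) x)"

lemma C_k_Suc: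
  "C_k (Suc k) f \<longleftrightarrow> (\<forall>x. f differentiable (at x)) \<and> (\<forall>i\<in>Basis. C_k k (partial i f))"
  by (simp add: partial_def[abs_def])

declare C_k.simps(2)[simp del]

lemma partial_eq:
  assumes "(f has_derivative f') (at x)"
  shows "partial i f x = f' i"
  using frechet_derivative_at[OF assms] by (simp add: partial_def)

text \<open>By uniqueness of the derivative, an explicit \<open>f'\<close> turns the partial
  derivatives in the recursion into concrete functions, to which induction hypotheses apply.\<close>

lemma C_k_SucI:
  assumes "\<And>x. (f has_derivative f' x) (at x)" and "\<And>i. i \<in> Basis \<Longrightarrow> C_k k (\<lambda>x. f' x i)"
  shows "C_k (Suc k) f"
proof -
  have "partial i f = (\<lambda>x. f' x i)" for i
    using partial_eq[OF assms(1)] by auto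
  then show ?thesis
    using assms by (auto simp: C_k_Suc differentiable_def)
qed

lemma C_k_continuous: "C_k k f \<Longrightarrow> continuous_on UNIV f"
  by (cases k) (auto simp: C_k_Suc intro!: continuous_at_imp_continuous_on differentiable_imp_continuous_within)

lemma C_k_mono: "C_k (Suc k) f \<Longrightarrow> C_k k f"
proof (induction k arbitrary: f)
  case 0
  then show ?case using C_k_continuous[of "Suc 0"] by simp
next
  case (Suc k)
  then show ?case by (auto simp: C_k_Suc[of "Suc k"] C_k_Suc[of k])
qed

lemma C_k_const: "C_k k (\<lambda>x. c)"
proof (induction k arbitrary: c)
  case (Suc k)
  then show ?case by (intro C_k_SucI[where f'="\<lambda>_ _. 0"]) auto
qed simp

lemma C_k_inner: "C_k k (\<lambda>x. x \<bullet> a)"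
proof (cases k)
  case (Suc k)
  show ?thesis unfolding Suc
    by (rule C_k_SucI[where f'="\<lambda>_ h. h \<bullet> a"])
       (auto intro!: derivative_eq_intros simp: C_k_const)
qed (auto intro!: continuous_intros)

lemma has_derivative_partial:
  assumes "C_k (Suc k) f"
  shows "(f has_derivative (\<lambda>h. partial h f x)) (at x)"
  using assms frechet_derivative_works unfolding C_k_Suc partial_def by blast

lemma C_k_add: "C_k k f \<Longrightarrow> C_k k g \<Longrightarrow> C_k k (\<lambda>x. f x + g x)"
proof (induction k arbitrary: f g)
  case (Suc k)
  have "C_k k (\<lambda>x. partial i f x + partial i g x)" if "i \<in> Basis" for i
    using Suc that by (auto simp: C_k_Suc)
  then show ?case
    by (intro C_k_SucI[where f'="\<lambda>x h. partial h f x + partial h g x"])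
       (auto intro!: has_derivative_add has_derivative_partial[OF Suc.prems(1)]
         has_derivative_partial[OF Suc.prems(2)])
qed (auto intro!: continuous_intros)

text \<open>Leibniz' rule writes each partial derivative as a sum of products of
  \<open>C_k k\<close> functions; the undifferentiated factors qualify through
  \<open>C_k_mono\<close>.\<close>

lemma C_k_mult: "C_k k f \<Longrightarrow> C_k k g \<Longrightarrow> C_k k (\<lambda>x. f x * g x)"
proof (induction k arbitrary: f g)
  case (Suc k)
  have "C_k k (\<lambda>x. f x * partial i g x + partial i f x * g x)" if "i \<in> Basis" for i
    using Suc that by (intro C_k_add Suc.IH) (auto simp: C_k_Suc C_k_mono)
  then show ?case
    by (intro C_k_SucI[where f'="\<lambda>x h. f x * partial h g x + partial h f x * g x"])
       (auto intro!: has_derivative_mult has_derivative_partial[OF Suc.prems(1)]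
         has_derivative_partial[OF Suc.prems(2)])
qed (auto intro!: continuous_intros)

lemma smooth_partial: "smooth f \<Longrightarrow> i \<in> Basis \<Longrightarrow> smooth (partial i f)"
  by (meson C_k_Suc smooth_def)

lemma smooth_continuous: "smooth f \<Longrightarrow> continuous_on S f"
  using C_k_continuous continuous_on_subset smooth_def by blast

lemma smooth_has_derivative:
  "smooth f \<Longrightarrow> (f has_derivative (\<lambda>h. partial h f x)) (at x)"
  using has_derivative_partial smooth_def by blast

text \<open>The power of \<open>1 / t\<close> makes this family closed under differentiation.\<close>

definition flat_exp :: "nat \<Rightarrow> real \<Rightarrow> real" where
  "flat_exp m t = (if t > 0 then exp (- inverse t) * inverse t ^ m else 0)"

lemma flat_exp_nonneg: "flat_exp m t \<ge> 0"
  by (simp add: flat_exp_def)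

text \<open>From the right, substituting \<open>s = 1 / t\<close> leaves the limit of
  \<open>s ^ m / exp s\<close> at infinity; on the left the function is identically zero.\<close>

lemma flat_exp_tendsto_0: "(flat_exp m \<longlongrightarrow> 0) (at 0)"
proof -
  have "((\<lambda>t. (inverse t) ^ m / exp (inverse t)) \<longlongrightarrow> 0) (at_right (0::real))"
    by (rule filterlim_compose[OF tendsto_power_div_exp_0 filterlim_inverse_at_top_right])
  moreover have "\<forall>\<^sub>F t in at_right 0. (inverse t) ^ m / exp (inverse t) = flat_exp m t"
    using eventually_at_right_less[of 0]
    by eventually_elim (auto simp: flat_exp_def exp_minus divide_inverse)
  ultimately have "(flat_exp m \<longlongrightarrow> 0) (at_right 0)"
    by (rule Lim_transform_eventually)
  moreover have "(flat_exp m \<longlongrightarrow> 0) (at_left 0)"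
  proof (rule tendsto_eventually)
    have "\<forall>\<^sub>F t in at_left 0. t < (0::real)"
      by (simp add: eventually_at_filter)
    then show "\<forall>\<^sub>F t in at_left 0. flat_exp m t = 0"
      by eventually_elim (auto simp: flat_exp_def)
  qed
  ultimately show ?thesis
    by (simp add: filterlim_split_at)
qed

lemma flat_exp_deriv:
  "(flat_exp m has_real_derivative (flat_exp (m + 2) t - m * flat_exp (m + 1) t)) (at t)"
proof -
  consider "t > 0" | "t = 0" | "t < 0" by linarith
  then show ?thesis
  proof cases
    case 1
    have "((\<lambda>t. exp (- inverse t) * inverse t ^ m) has_real_derivative
        (flat_exp (m + 2) t - m * flat_exp (m + 1) t)) (at t)"
    proof (rule DERIV_cong)
      have inv: "(inverse has_real_derivative - (inverse t * inverse t)) (at t)"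
        using 1 by (auto intro!: derivative_eq_intros)
      show "((\<lambda>t. exp (- inverse t) * inverse t ^ m) has_real_derivative
          exp (- inverse t) * - (- (inverse t * inverse t)) * inverse t ^ m
          + real m * (- (inverse t * inverse t) * inverse t ^ (m - Suc 0)) * exp (- inverse t)) (at t)"
        by (intro DERIV_mult DERIV_fun_exp DERIV_minus DERIV_power inv)
      show "exp (- inverse t) * - (- (inverse t * inverse t)) * inverse t ^ m
          + real m * (- (inverse t * inverse t) * inverse t ^ (m - Suc 0)) * exp (- inverse t)
          = flat_exp (m + 2) t - m * flat_exp (m + 1) t"
        \<comment> \<open>The case split handles the truncated exponent \<open>m - Suc 0\<close>,
          whose term has coefficient 0 when \<open>m = 0\<close>.\<close>
        using 1 by (cases m) (simp_all add: flat_exp_def algebra_simps del: inverse_eq_divide)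
    qed
    moreover have "\<forall>\<^sub>F x in nhds t. exp (- inverse x) * inverse x ^ m = flat_exp m x"
      using eventually_nhds_in_open[of "{0<..}" t] 1
      by (auto elim!: eventually_mono simp: flat_exp_def)
    ultimately show ?thesis
      by (simp add: DERIV_cong_ev)
  next
    case 2
    \<comment> \<open>Since \<open>flat_exp m 0 = 0\<close>, the difference quotient at the origin
      is the next member of the family, whose limit is known. The identity holds for every
      \<open>h\<close>, because division by zero yields zero.\<close>
    have "\<forall>\<^sub>F h in at (0::real). flat_exp (Suc m) h = (flat_exp m h - flat_exp m 0) / h"
      by (rule always_eventually) (auto simp: flat_exp_def divide_inverse)
    then have "((\<lambda>h. (flat_exp m h - flat_exp m 0) / h) \<longlongrightarrow> 0) (at 0)"
      by (rule Lim_transform_eventually[OF flat_exp_tendsto_0])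
    then show ?thesis
      using 2 by (simp add: has_field_derivative_iff flat_exp_def)
  next
    case 3
    have "\<forall>\<^sub>F x in nhds t. flat_exp m x = 0"
      using eventually_nhds_in_open[of "{..<0}" t] 3
      by (auto elim!: eventually_mono simp: flat_exp_def)
    from DERIV_cong_ev[OF refl this refl] have "(flat_exp m has_real_derivative 0) (at t)"
      by simp
    then show ?thesis using 3 by (simp add: flat_exp_def)
  qed
qed

text \<open>The squared norm keeps the argument polynomial, hence smooth also at \<open>y\<close>.
  The bump is not normalised; its mass is carried along as a factor later.\<close>

definition bump :: "'a::euclidean_space \<Rightarrow> real \<Rightarrow> 'a \<Rightarrow> real" where
  "bump y \<delta> x = flat_exp 0 (\<delta>\<^sup>2 - (norm (x - y))\<^sup>2)"

text \<open>The chain rule produces an affine function times members of the family with exponents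
  \<open>m + 1\<close> and \<open>m + 2\<close>, so the induction on \<open>k\<close> has to let
  \<open>m\<close> vary.\<close>

lemma C_k_flat_exp: "C_k k (\<lambda>x. flat_exp m (\<delta>\<^sup>2 - (norm (x - y))\<^sup>2))"
proof (induction k arbitrary: m)
  case 0
  have "continuous_on UNIV (flat_exp m)"
    by (intro continuous_at_imp_continuous_on ballI DERIV_isCont[OF flat_exp_deriv])
  then have "continuous_on UNIV (\<lambda>x. flat_exp m (\<delta>\<^sup>2 - (norm (x - y))\<^sup>2))"
    by (rule continuous_on_compose2) (auto intro!: continuous_intros)
  then show ?case by simp
next
  case (Suc k)
  let ?s = "\<lambda>x. \<delta>\<^sup>2 - (norm (x - y))\<^sup>2"
  let ?D = "\<lambda>x h. -2 * ((x - y) \<bullet> h) * (flat_exp (m + 2) (?s x) - m * flat_exp (m + 1) (?s x))"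
  have s: "(?s has_derivative (\<lambda>h. -2 * ((x - y) \<bullet> h))) (at x)" for x
    unfolding power2_norm_eq_inner
    by (auto intro!: derivative_eq_intros simp: inner_commute)
  show ?case
  proof (rule C_k_SucI[where f'="?D"])
    show "((\<lambda>x. flat_exp m (?s x)) has_derivative ?D x) (at x)" for x
      by (rule DERIV_compose_FDERIV[OF flat_exp_deriv s])
    fix i :: 'a
    \<comment> \<open>Differences are written as sums with negated constants, so closure under sums
      and products is enough.\<close>
    have "C_k k (\<lambda>x. -2 * (x \<bullet> i + (- (y \<bullet> i))) *
        (flat_exp (m + 2) (?s x) + (- m) * flat_exp (m + 1) (?s x)))"
      by (intro C_k_mult C_k_add C_k_const C_k_inner Suc.IH)
    then show "C_k k (\<lambda>x. ?D x i)"
      by (simp add: inner_diff_left)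
  qed
qed

lemma smooth_bump: "smooth (bump y \<delta>)"
  using C_k_flat_exp by (auto simp: smooth_def bump_def[abs_def])

lemma bump_nonneg: "bump y \<delta> x \<ge> 0"
  by (simp add: bump_def flat_exp_nonneg)

lemma bump_nonzero_iff:
  assumes "\<delta> > 0"
  shows "bump y \<delta> x \<noteq> 0 \<longleftrightarrow> x \<in> ball y \<delta>"
proof -
  have "bump y \<delta> x \<noteq> 0 \<longleftrightarrow> (norm (x - y))\<^sup>2 < \<delta>\<^sup>2"
    by (simp add: bump_def flat_exp_def)
  also have "\<dots> \<longleftrightarrow> norm (x - y) < \<delta>"
    using assms by (meson linorder_not_less norm_ge_zero order_less_imp_le power_mono power_strict_mono zero_less_numeral)
  finally show ?thesis
    by (simp add: dist_norm norm_minus_commute)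
qed

lemma bump_support:
  assumes "\<delta> > 0"
  shows "closure {x. bump y \<delta> x \<noteq> 0} = cball y \<delta>"
proof -
  have "{x. bump y \<delta> x \<noteq> 0} = ball y \<delta>"
    using bump_nonzero_iff[OF assms] by blast
  then show ?thesis
    using assms by simp
qed

lemma bump_test_function:
  assumes "\<delta> > 0" "cball y \<delta> \<subseteq> \<Omega>"
  shows "bump y \<delta> \<in> test_functions \<Omega>"
  unfolding test_functions_def mem_Collect_eq bump_support[OF assms(1)]
  using assms(2) by (simp add: smooth_bump)

lemma bump_translate: "bump (y + a) \<delta> x = bump y \<delta> (x - a)"
  by (simp add: bump_def algebra_simps)

subsection \<open>Integration by parts against test functions\<close>

text \<open>Reduces partial derivatives to one real variable, where the mean value and Taylor
  theorems apply. Homogeneity of the derivative in the direction identifies the slope.\<close>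

lemma partial_along_line:
  assumes "smooth f"
  shows "((\<lambda>t. f (x + t *\<^sub>R i)) has_real_derivative partial i f (x + t *\<^sub>R i)) (at t)"
proof -
  have 1: "((\<lambda>t. x + t *\<^sub>R i) has_derivative (\<lambda>t. t *\<^sub>R i)) (at t)"
    by (auto intro!: derivative_eq_intros)
  have 2: "((\<lambda>t. f (x + t *\<^sub>R i)) has_derivative (\<lambda>s. partial (s *\<^sub>R i) f (x + t *\<^sub>R i))) (at t)"
    using has_derivative_compose[OF 1 smooth_has_derivative[OF assms]] .
  have "partial (s *\<^sub>R i) f y = partial i f y * s" for s y
    using linear_scale[OF has_derivative_linear[OF smooth_has_derivative[OF assms, of y]]] by simp
  with 2 show ?thesis
    by (simp add: has_field_derivative_def mult_commute_abs)
qed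

lemma partial_mult:
  assumes "smooth f" "smooth g"
  shows "partial i (\<lambda>x. f x * g x) x = f x * partial i g x + partial i f x * g x"
  by (rule partial_eq[OF has_derivative_mult[OF smooth_has_derivative[OF assms(1)]
        smooth_has_derivative[OF assms(2)]]])

text \<open>Off its closed support \<open>f\<close> vanishes on an open set, so its derivative
  vanishes there too: differentiation does not enlarge supports.\<close>

lemma test_functions_partial:
  assumes "f \<in> test_functions \<Omega>" "i \<in> Basis"
  shows "partial i f \<in> test_functions \<Omega>"
proof -
  let ?S = "closure {x. f x \<noteq> 0}"
  have "partial i f x = 0" if x: "x \<notin> ?S" for x
  proof (rule partial_eq)
    show "(f has_derivative (\<lambda>_. 0)) (at x)"
    proof (rule has_derivative_transform_within_open[OF has_derivative_const])
      show "open (- ?S)"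
        by (rule open_Compl[OF closed_closure])
      show "x \<in> - ?S"
        using x by (simp only: Compl_iff not_False_eq_True)
      show "0 = f y" if y: "y \<in> - ?S" for y
      proof (rule ccontr)
        assume "0 \<noteq> f y"
        then have "y \<in> {x. f x \<noteq> 0}" by simp
        then show False
          using closure_subset[of "{x. f x \<noteq> 0}"] y by blast
      qed
    qed
  qed
  then have "{x. partial i f x \<noteq> 0} \<subseteq> ?S"
    by blast
  then have sub: "closure {x. partial i f x \<noteq> 0} \<subseteq> ?S"
    by (rule closure_minimal) (rule closed_closure)
  have S: "smooth f" "compact ?S" "?S \<subseteq> \<Omega>"
    using assms(1) unfolding test_functions_def by blast+
  have "compact (?S \<inter> closure {x. partial i f x \<noteq> 0})"
    using S(2) by (rule compact_Int_closed) (rule closed_closure)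
  with sub have "compact (closure {x. partial i f x \<noteq> 0})"
    by (simp only: Int_absorb1)
  with sub S smooth_partial[OF S(1) assms(2)] show ?thesis
    unfolding test_functions_def by blast
qed

lemma test_functions_support:
  assumes "f \<in> test_functions \<Omega>"
  obtains K where "compact K" "K \<subseteq> \<Omega>" "\<And>x. x \<notin> K \<Longrightarrow> f x = 0"
proof
  show "compact (closure {x. f x \<noteq> 0})" "closure {x. f x \<noteq> 0} \<subseteq> \<Omega>"
    using assms by (auto simp: test_functions_def)
  show "f x = 0" if "x \<notin> closure {x. f x \<noteq> 0}" for x
    using that closure_subset[of "{x. f x \<noteq> 0}"] by blast
qed

section \<open>Integrability of functions with compact support\<close>

lemma continuous_compact_support_bounded:
  fixes f :: "'a::metric_space \<Rightarrow> 'b::real_normed_vector"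
  assumes "continuous_on UNIV f" "compact K" "\<And>x. x \<notin> K \<Longrightarrow> f x = 0"
  shows "\<exists>B\<ge>0. \<forall>x. norm (f x) \<le> B"
proof -
  have "bounded (f ` K)"
    using assms by (meson compact_continuous_image compact_imp_bounded continuous_on_subset subset_UNIV)
  then obtain B where "\<And>x. x \<in> K \<Longrightarrow> norm (f x) \<le> B"
    by (auto simp: bounded_iff)
  \<comment> \<open>For empty \<open>K\<close> the bound \<open>B\<close> is unconstrained and may
    be negative, hence the maximum with 0.\<close>
  then have "norm (f x) \<le> max B 0" for x
    using assms(3)[of x] by (cases "x \<in> K") force+
  then show ?thesis
    by (intro exI[of _ "max B 0"]) simp
qed

lemma measurable_lebesgue_continuous:
  fixes f :: "'a::euclidean_space \<Rightarrow> 'b::euclidean_space"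
  shows "continuous_on UNIV f \<Longrightarrow> f \<in> borel_measurable lebesgue"
  by (intro measurable_completion) (simp add: borel_measurable_continuous_onI)

lemma continuous_L1_loc:
  fixes f :: "'a::euclidean_space \<Rightarrow> 'b::euclidean_space"
  assumes "continuous_on \<Omega> f"
  shows "f \<in> L1_loc \<Omega>"
  unfolding L1_loc_def
proof safe
  fix K assume "compact K" "K \<subseteq> \<Omega>"
  then have "integrable lborel (\<lambda>x. indicator K x *\<^sub>R f x)"
    using borel_integrable_compact continuous_on_subset[OF assms] by blast
  then show "set_integrable lebesgue K f"
    unfolding set_integrable_def by (simp add: integrable_completion borel_measurable_integrable)
qed

text \<open>Local integrability of \<open>w\<close> suffices: \<open>\<psi>\<close> is bounded and
  lives on a compact subset of \<open>\<Omega>\<close>, so a multiple of \<open>w\<close> restricted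
  to that set is a majorant.\<close>

lemma integrable_mult_compact_support:
  fixes w :: "'a::euclidean_space \<Rightarrow> 'b::euclidean_space"
  assumes "w \<in> L1_loc \<Omega>" "continuous_on UNIV \<psi>" "compact K" "K \<subseteq> \<Omega>" "\<And>x. x \<notin> K \<Longrightarrow> \<psi> x = 0"
  shows "integrable lebesgue (\<lambda>x. \<psi> x *\<^sub>R w x)"
proof -
  obtain B where B: "B \<ge> 0" "\<And>x. norm (\<psi> x) \<le> B"
    using continuous_compact_support_bounded[OF assms(2,3,5)] by blast
  have eq: "(\<lambda>x. \<psi> x *\<^sub>R w x) = (\<lambda>x. \<psi> x *\<^sub>R (indicator K x *\<^sub>R w x))"
    using assms(5) by (auto simp: fun_eq_iff split: split_indicator)
  have int: "integrable lebesgue (\<lambda>x. indicator K x *\<^sub>R w x)"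
    using assms by (auto simp: L1_loc_def set_integrable_def)
  show ?thesis
    unfolding eq
  proof (rule Bochner_Integration.integrable_bound)
    show "integrable lebesgue (\<lambda>x. B *\<^sub>R (indicator K x *\<^sub>R w x))"
      using int by (intro integrable_scaleR_right)
    show "(\<lambda>x. \<psi> x *\<^sub>R indicat_real K x *\<^sub>R w x) \<in> borel_measurable lebesgue"
      by (rule borel_measurable_scaleR[OF measurable_lebesgue_continuous[OF assms(2)]
            borel_measurable_integrable[OF int]])
    have "norm (\<psi> x *\<^sub>R indicat_real K x *\<^sub>R w x) \<le> norm (B *\<^sub>R indicat_real K x *\<^sub>R w x)" for x
      unfolding norm_scaleR[of "\<psi> x"] norm_scaleR[of B]
      using B(2)[of x] by (intro mult_right_mono) auto
    then show "AE x in lebesgue. norm (\<psi> x *\<^sub>R indicat_real K x *\<^sub>R w x)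
        \<le> norm (B *\<^sub>R indicat_real K x *\<^sub>R w x)"
      by blast
  qed
qed

lemma integrable_compact_support:
  fixes f :: "'a::euclidean_space \<Rightarrow> real"
  assumes "continuous_on UNIV f" "compact K" "\<And>x. x \<notin> K \<Longrightarrow> f x = 0"
  shows "integrable lebesgue f"
  using integrable_mult_compact_support[OF continuous_L1_loc[of UNIV "\<lambda>_. 1 :: real"] assms(1,2) _ assms(3)]
  by simp

lemma set_integral_compact_support:
  fixes f :: "'a::euclidean_space \<Rightarrow> real"
  assumes "K \<subseteq> \<Omega>" "\<And>x. x \<notin> K \<Longrightarrow> f x = 0"
  shows "(LINT x:\<Omega>|lebesgue. f x) = (LINT x|lebesgue. f x)"
  unfolding set_lebesgue_integral_def
  using assms by (intro Bochner_Integration.integral_cong) (auto split: split_indicator)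

text \<open>Invariance comes from \<open>lborel\<close>; continuity makes \<open>f\<close> Borel
  measurable, which allows the passage between \<open>lborel\<close> and its completion.\<close>

lemma integral_translate:
  fixes f :: "'a::euclidean_space \<Rightarrow> real"
  assumes "continuous_on UNIV f"
  shows "(LINT x|lebesgue. f (x + a)) = (LINT x|lebesgue. f x)"
proof -
  have m: "f \<in> borel_measurable borel"
    using assms by (rule borel_measurable_continuous_onI)
  have "(LINT x|lebesgue. f x) = (LINT x|distr lborel borel ((+) a). f x)"
    using m by (simp add: integral_completion lborel_distr_plus)
  also have "\<dots> = (LINT x|lborel. f (x + a))"
    using m by (subst integral_distr) (auto simp: add.commute)
  also have "\<dots> = (LINT x|lebesgue. f (x + a))"
    using m by (subst integral_completion) auto
  finally show ?thesis ..
qed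

text \<open>Translation invariance makes the integral of every difference quotient vanish.\<close>

lemma integral_partial_eq_0:
  assumes f: "smooth f" and K: "compact K" "\<And>x. x \<notin> K \<Longrightarrow> f x = 0" and i: "i \<in> Basis"
  shows "(LINT x|lebesgue. partial i f x) = 0"
proof -
  define h where "h n = 1 / real (Suc n)" for n
  have h: "h n > 0" "h n \<le> 1" for n by (auto simp: h_def)
  have "h \<longlonglongrightarrow> 0"
    unfolding h_def by (rule LIMSEQ_Suc[OF lim_1_over_n])
  then have h0: "filterlim h (at 0) sequentially"
    using h(1) by (auto simp: filterlim_at intro!: always_eventually) (metis less_irrefl)
  have cont: "continuous_on UNIV f" "continuous_on UNIV (partial i f)"
    using f i by (auto intro: smooth_continuous smooth_partial)
  have "{x. f x \<noteq> 0} \<subseteq> K"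
    using K(2) by blast
  then have "compact (closure {x. f x \<noteq> 0})"
    using K(1) by (meson bounded_subset compact_closure compact_imp_bounded)
  then have "f \<in> test_functions UNIV"
    using f unfolding test_functions_def by blast
  then have "partial i f \<in> test_functions UNIV"
    using i by (rule test_functions_partial)
  then obtain K' where K': "compact K'" "\<And>x. x \<notin> K' \<Longrightarrow> partial i f x = 0"
    by (rule test_functions_support) blast
  obtain B where B: "B \<ge> 0" "\<And>x. norm (partial i f x) \<le> B"
    using continuous_compact_support_bounded[OF cont(2) K'] by blast
  obtain R where R: "\<And>x. x \<in> K \<Longrightarrow> norm x \<le> R"
    using compact_imp_bounded[OF K(1)] by (auto simp: bounded_iff)
  define s where "s n x = (f (x + h n *\<^sub>R i) - f x) / h n" for n x
  have int: "integrable lebesgue f"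
    using integrable_compact_support[OF cont(1) K] .
  have contn: "continuous_on UNIV (\<lambda>x. f (x + h n *\<^sub>R i))" for n
    by (rule continuous_on_compose2[OF cont(1)]) (auto intro!: continuous_intros)
  have intn: "integrable lebesgue (\<lambda>x. f (x + h n *\<^sub>R i))" for n
  proof (rule integrable_compact_support[OF contn])
    show "compact ((\<lambda>x. x - h n *\<^sub>R i) ` K)"
      using K(1) by (simp add: compact_translation_subtract)
    fix x assume "x \<notin> (\<lambda>x. x - h n *\<^sub>R i) ` K"
    then have "x + h n *\<^sub>R i \<notin> K"
      by (auto simp: image_iff)
    then show "f (x + h n *\<^sub>R i) = 0"
      by (rule K(2))
  qed
  have "(\<lambda>n. LINT x|lebesgue. s n x) \<longlonglongrightarrow> (LINT x|lebesgue. partial i f x)"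
  \<comment> \<open>By the mean value theorem the quotients are bounded by \<open>B\<close>. The
    steps \<open>h n\<close> are at most 1, so all quotients vanish outside the ball of radius
    \<open>R + 1\<close>.\<close>
  proof (rule integral_dominated_convergence[where w="\<lambda>x. B * indicator (cball 0 (R + 1)) x"])
    show "partial i f \<in> borel_measurable lebesgue"
      using cont by (simp add: measurable_lebesgue_continuous)
    show "s n \<in> borel_measurable lebesgue" for n
      using int intn[of n] unfolding s_def by measurable
    show "integrable lebesgue (\<lambda>x. B * indicat_real (cball 0 (R + 1)) x)"
      by (intro integrable_mult_right integrable_real_indicator) (use emeasure_lborel_cball_finite[of 0 "R + 1"] in \<open>auto simp: less_top[symmetric]\<close>)
    have "(\<lambda>n. s n x) \<longlonglongrightarrow> partial i f x" for x
    proof -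
      have "((\<lambda>t. (f (x + t *\<^sub>R i) - f x) / t) \<longlongrightarrow> partial i f x) (at 0)"
        using partial_along_line[OF f, of x i 0] by (simp add: has_field_derivative_iff)
      then show ?thesis
        unfolding s_def by (rule filterlim_compose[OF _ h0])
    qed
    then show "AE x in lebesgue. (\<lambda>n. s n x) \<longlonglongrightarrow> partial i f x"
      by simp
    have "norm (s n x) \<le> B * indicator (cball 0 (R + 1)) x" for n x
    proof (cases "x \<in> cball 0 (R + 1)")
      case True
      obtain t where "f (x + h n *\<^sub>R i) - f (x + 0 *\<^sub>R i) = (h n - 0) * partial i f (x + t *\<^sub>R i)"
        using MVT2[OF h(1)[of n] partial_along_line[OF f, of x i]] by blast
      then show ?thesis
        using True h(1)[of n] B(2)[of "x + t *\<^sub>R i"] by (simp add: s_def)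
    next
      case False
      then have "R + 1 < norm x" by simp
      also have "\<dots> \<le> norm (x + h n *\<^sub>R i) + norm (h n *\<^sub>R i)"
        using norm_triangle_ineq4[of "x + h n *\<^sub>R i" "h n *\<^sub>R i"] by simp
      also have "norm (h n *\<^sub>R i) \<le> 1"
        using h[of n] i by simp
      finally have "x + h n *\<^sub>R i \<notin> K"
        using R by fastforce
      moreover have "x \<notin> K"
        using R False by fastforce
      ultimately show ?thesis
        using K(2) False by (simp add: s_def)
    qed
    then show "AE x in lebesgue. norm (s n x) \<le> B * indicat_real (cball 0 (R + 1)) x" for n
      by simp
  qed
  moreover have "(LINT x|lebesgue. s n x) = 0" for n
    using int intn[of n] integral_translate[OF cont(1), of "h n *\<^sub>R i"] by (simp add: s_def)
  ultimately show ?thesis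
    by (simp add: LIMSEQ_const_iff)
qed

text \<open>The product is smooth with compact support, so its partial derivative integrates to
  zero; the product rule splits that integral.\<close>

lemma test_functions_integration_by_parts:
  assumes \<psi>: "\<psi> \<in> test_functions \<Omega>" and \<phi>: "\<phi> \<in> test_functions \<Omega>" and i: "i \<in> Basis"
  shows "(LINT x:\<Omega>|lebesgue. \<psi> x * partial i \<phi> x) = - (LINT x:\<Omega>|lebesgue. partial i \<psi> x * \<phi> x)"
proof -
  have sm: "smooth \<psi>" "smooth \<phi>"
    using \<psi> \<phi> by (auto simp: test_functions_def)
  have smm: "smooth (\<lambda>x. \<psi> x * \<phi> x)"
    using sm by (auto simp: smooth_def intro: C_k_mult)
  obtain K where K: "compact K" "K \<subseteq> \<Omega>" "\<And>x. x \<notin> K \<Longrightarrow> \<psi> x = 0"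
    by (rule test_functions_support[OF \<psi>]) blast
  obtain L where L: "compact L" "L \<subseteq> \<Omega>" "\<And>x. x \<notin> L \<Longrightarrow> \<phi> x = 0"
    by (rule test_functions_support[OF \<phi>]) blast
  have c: "continuous_on UNIV \<psi>" "continuous_on UNIV \<phi>"
      "continuous_on UNIV (partial i \<psi>)" "continuous_on UNIV (partial i \<phi>)"
    using sm i by (auto intro: smooth_continuous smooth_partial)
  have int: "integrable lebesgue (\<lambda>x. \<psi> x * partial i \<phi> x)"
     "integrable lebesgue (\<lambda>x. partial i \<psi> x * \<phi> x)"
    by (rule integrable_compact_support[OF _ K(1)], auto intro!: continuous_intros c simp: K(3))
       (rule integrable_compact_support[OF _ L(1)], auto intro!: continuous_intros c simp: L(3))
  have "0 = (LINT x|lebesgue. partial i (\<lambda>x. \<psi> x * \<phi> x) x)"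
    using integral_partial_eq_0[OF smm K(1) _ i] K(3) by simp
  also have "\<dots> = (LINT x|lebesgue. \<psi> x * partial i \<phi> x) + (LINT x|lebesgue. partial i \<psi> x * \<phi> x)"
    unfolding partial_mult[OF sm] using int by simp
  also have "(LINT x|lebesgue. \<psi> x * partial i \<phi> x) = (LINT x:\<Omega>|lebesgue. \<psi> x * partial i \<phi> x)"
    by (rule set_integral_compact_support[symmetric, OF K(2)]) (simp add: K(3))
  also have "(LINT x|lebesgue. partial i \<psi> x * \<phi> x) = (LINT x:\<Omega>|lebesgue. partial i \<psi> x * \<phi> x)"
    by (rule set_integral_compact_support[symmetric, OF L(2)]) (simp add: L(3))
  finally show ?thesis by simp
qed

section \<open>Test functions as members of the Sobolev space\<close>

definition grad :: "('a::euclidean_space \<Rightarrow> real) \<Rightarrow> 'a \<Rightarrow> 'a" where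
  "grad f x = (\<Sum>i\<in>Basis. partial i f x *\<^sub>R i)"

text \<open>Integration by parts against a second test function makes the classical gradient a weak
  one. This provides the explicit \<open>D\<psi>\<close> with which a test function enters
  \<open>L_subharmonic\<close>.\<close>

lemma test_function_weak_gradient:
  assumes "\<psi> \<in> test_functions \<Omega>"
  shows "has_weak_gradient \<Omega> \<psi> (grad \<psi>)"
  unfolding has_weak_gradient_def
proof (intro conjI ballI)
  have sm: "smooth \<psi>"
    using assms by (auto simp: test_functions_def)
  then show "\<psi> \<in> L1_loc \<Omega>"
    by (intro continuous_L1_loc smooth_continuous)
  have "continuous_on \<Omega> (grad \<psi>)"
    unfolding grad_def using sm by (intro continuous_intros smooth_continuous smooth_partial)
  then show "grad \<psi> \<in> L1_loc \<Omega>"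
    by (rule continuous_L1_loc)
  show "(LINT x:\<Omega>|lebesgue. \<psi> x * frechet_derivative \<phi> (at x) i) =
      - (LINT x:\<Omega>|lebesgue. grad \<psi> x \<bullet> i * \<phi> x)" if "\<phi> \<in> test_functions \<Omega>" "i \<in> Basis" for \<phi> i
    using test_functions_integration_by_parts[OF assms that] that
    by (simp add: partial_def grad_def)
qed

lemma continuous_compact_support_L2:
  fixes f :: "'a::euclidean_space \<Rightarrow> 'b::euclidean_space"
  assumes "open \<Omega>" "continuous_on UNIV f" "compact K" "\<And>x. x \<notin> K \<Longrightarrow> f x = 0"
  shows "f \<in> L2 \<Omega>"
proof -
  have \<Omega>: "\<Omega> \<in> sets lebesgue"
    using assms(1) by simp
  have "integrable lebesgue (\<lambda>x. (norm (f x))\<^sup>2)"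
    by (rule integrable_compact_support[OF _ assms(3)]) (auto intro!: continuous_intros assms)
  then have "set_integrable lebesgue \<Omega> (\<lambda>x. (norm (f x))\<^sup>2)"
    unfolding set_integrable_def by (rule integrable_mult_indicator[OF \<Omega>])
  moreover have "set_borel_measurable lebesgue \<Omega> f"
    unfolding set_borel_measurable_def
    by (rule borel_measurable_scaleR[OF borel_measurable_indicator[OF \<Omega>]
          measurable_lebesgue_continuous[OF assms(2)]])
  ultimately show ?thesis
    by (simp add: L2_def)
qed

lemma test_function_H1:
  assumes "open \<Omega>" "\<psi> \<in> test_functions \<Omega>"
  shows "\<psi> \<in> H1 \<Omega>"
proof -
  have sm: "smooth \<psi>"
    using assms by (auto simp: test_functions_def)
  let ?K = "closure {x. \<psi> x \<noteq> 0}"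
  have K: "compact ?K"
    using assms by (auto simp: test_functions_def)
  have "\<psi> x = 0" if "x \<notin> ?K" for x
    using that closure_subset[of "{x. \<psi> x \<noteq> 0}"] by blast
  then have 1: "\<psi> \<in> L2 \<Omega>"
    using sm by (intro continuous_compact_support_L2[OF assms(1) _ K] smooth_continuous)
  have "compact (\<Union>i\<in>Basis. closure {x. partial i \<psi> x \<noteq> 0})"
    using test_functions_partial[OF assms(2)] by (intro compact_UN) (auto simp: test_functions_def)
  moreover have "grad \<psi> x = 0" if "x \<notin> (\<Union>i\<in>Basis. closure {x. partial i \<psi> x \<noteq> 0})" for x
    using that closure_subset unfolding grad_def by (intro sum.neutral) force
  moreover have "continuous_on UNIV (grad \<psi>)"
    unfolding grad_def using sm by (intro continuous_intros smooth_continuous smooth_partial)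
  ultimately have "grad \<psi> \<in> L2 \<Omega>"
    using continuous_compact_support_L2[OF assms(1)] by blast
  with 1 show ?thesis
    using test_function_weak_gradient[OF assms(2)] by (auto simp: H1_def)
qed

section \<open>From the weak formulation to a distributional inequality\<close>

lemma boundary_dist_pos:
  assumes "open \<Omega>" "frontier \<Omega> \<noteq> {}" "x \<in> \<Omega>"
  shows "boundary_dist \<Omega> x > 0"
  unfolding boundary_dist_def
  \<comment> \<open>An open set misses its closed frontier. Nonemptiness excludes the convention
    that the distance to the empty set is 0.\<close>
  by (rule infdist_pos_not_in_closed) (use assms in \<open>auto simp: frontier_def interior_open\<close>)

lemma continuous_on_boundary_dist: "continuous_on S (boundary_dist \<Omega>)"
  unfolding boundary_dist_def by (intro continuous_intros)

text \<open>Each \<open>partial i \<psi>\<close> is again a test function, so the definition of the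
  weak gradient moves the remaining derivative from \<open>u\<close> onto \<open>\<psi>\<close>. The
  weak gradient of \<open>u\<close> disappears and only values of \<open>u\<close> are left.\<close>

lemma L_subharmonic_distributional:
  assumes "open \<Omega>" "frontier \<Omega> \<noteq> {}" and u: "L_subharmonic \<kappa> \<Omega> u"
    and \<psi>: "\<psi> \<in> test_functions \<Omega>" "\<And>x. \<psi> x \<ge> 0"
  shows "- (LINT x:\<Omega>|lebesgue. u x * laplacian \<psi> x)
    \<le> (LINT x:\<Omega>|lebesgue. (\<kappa> * u x / (boundary_dist \<Omega> x)\<^sup>2) * \<psi> x)"
proof -
  obtain Du where Du: "has_weak_gradient \<Omega> u Du"
    using u by (auto simp: L_subharmonic_def H1_loc_def)
  obtain K where K: "compact K" "K \<subseteq> \<Omega>" "\<And>x. x \<notin> K \<Longrightarrow> \<psi> x = 0"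
    by (rule test_functions_support[OF \<psi>(1)]) blast
  have le: "(LINT x:\<Omega>|lebesgue. Du x \<bullet> grad \<psi> x)
      \<le> \<kappa> * (LINT x:\<Omega>|lebesgue. u x * \<psi> x / (boundary_dist \<Omega> x)\<^sup>2)"
  proof -
    have "AE x in lebesgue. x \<in> \<Omega> \<longrightarrow> \<psi> x \<ge> 0" "AE x in lebesgue. x \<in> \<Omega> - K \<longrightarrow> \<psi> x = 0"
      using \<psi>(2) K(3) by auto
    then show ?thesis
      using u K(1,2) test_function_H1[OF assms(1) \<psi>(1)] Du test_function_weak_gradient[OF \<psi>(1)]
      unfolding L_subharmonic_def diff_le_0_iff_le by blast
  qed
  have u1: "u \<in> L1_loc \<Omega>" "Du \<in> L1_loc \<Omega>"
    using Du by (auto simp: has_weak_gradient_def)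
  have int1: "set_integrable lebesgue \<Omega> (\<lambda>x. (Du x \<bullet> i) * partial i \<psi> x)"
    and int2: "set_integrable lebesgue \<Omega> (\<lambda>x. u x * partial i (partial i \<psi>) x)" if "i \<in> Basis" for i
  proof -
    have 1: "partial i \<psi> \<in> test_functions \<Omega>"
      using test_functions_partial \<psi>(1) that by blast
    obtain L where L: "compact L" "L \<subseteq> \<Omega>" "\<And>x. x \<notin> L \<Longrightarrow> partial i \<psi> x = 0"
      by (rule test_functions_support[OF 1]) blast
    have "integrable lebesgue (\<lambda>x. partial i \<psi> x *\<^sub>R Du x)"
      using 1 by (intro integrable_mult_compact_support[OF u1(2) _ L])
        (auto simp: test_functions_def intro: smooth_continuous)
    then have "integrable lebesgue (\<lambda>x. (partial i \<psi> x *\<^sub>R Du x) \<bullet> i)"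
      by (rule integrable_inner_left)
    then show "set_integrable lebesgue \<Omega> (\<lambda>x. (Du x \<bullet> i) * partial i \<psi> x)"
      unfolding set_integrable_def using assms(1)
      by (intro integrable_mult_indicator) (auto simp: mult.commute)
    have 2: "partial i (partial i \<psi>) \<in> test_functions \<Omega>"
      using test_functions_partial 1 that by blast
    obtain M where M: "compact M" "M \<subseteq> \<Omega>" "\<And>x. x \<notin> M \<Longrightarrow> partial i (partial i \<psi>) x = 0"
      by (rule test_functions_support[OF 2]) blast
    have "integrable lebesgue (\<lambda>x. partial i (partial i \<psi>) x *\<^sub>R u x)"
      using 2 by (intro integrable_mult_compact_support[OF u1(1) _ M])
        (auto simp: test_functions_def intro: smooth_continuous)
    then show "set_integrable lebesgue \<Omega> (\<lambda>x. u x * partial i (partial i \<psi>) x)"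
      unfolding set_integrable_def using assms(1)
      by (intro integrable_mult_indicator) (auto simp: mult.commute)
  qed
  have "(LINT x:\<Omega>|lebesgue. Du x \<bullet> grad \<psi> x)
      = (LINT x:\<Omega>|lebesgue. (\<Sum>i\<in>Basis. (Du x \<bullet> i) * partial i \<psi> x))"
    by (simp add: grad_def inner_sum_right mult.commute)
  also have "\<dots> = (\<Sum>i\<in>Basis. LINT x:\<Omega>|lebesgue. (Du x \<bullet> i) * partial i \<psi> x)"
    using int1 unfolding set_lebesgue_integral_def set_integrable_def scaleR_sum_right
    by (intro Bochner_Integration.integral_sum)
  also have "\<dots> = (\<Sum>i\<in>Basis. - (LINT x:\<Omega>|lebesgue. u x * partial i (partial i \<psi>) x))"
  proof (rule sum.cong[OF refl])
    fix i :: 'a assume "i \<in> Basis"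
    then show "(LINT x:\<Omega>|lebesgue. (Du x \<bullet> i) * partial i \<psi> x)
        = - (LINT x:\<Omega>|lebesgue. u x * partial i (partial i \<psi>) x)"
      using Du test_functions_partial[OF \<psi>(1)]
      by (simp add: has_weak_gradient_def partial_def[of _ "partial _ _"])
  qed
  also have "\<dots> = - (LINT x:\<Omega>|lebesgue. u x * laplacian \<psi> x)"
    using int2 unfolding set_lebesgue_integral_def set_integrable_def laplacian_def
      sum_distrib_left scaleR_sum_right sum_negf
    by (intro arg_cong[of _ _ uminus] Bochner_Integration.integral_sum[symmetric])
  finally show ?thesis
    using le by (simp add: set_integral_mult_right[symmetric] algebra_simps del: set_integral_mult_right)
qed

subsection \<open>Second differences and mollification\<close>

text \<open>Second-order Taylor expansions at \<open>h\<close> and \<open>- h\<close>, whose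
  first-order terms cancel in the sum. Each expansion keeps its own Lagrange point, \<open>s\<close>
  or \<open>t\<close>.\<close>

lemma second_difference_eq:
  fixes g g' g'' :: "real \<Rightarrow> real"
  assumes "\<And>t. \<bar>t\<bar> \<le> \<bar>h\<bar> \<Longrightarrow> (g has_real_derivative g' t) (at t)"
    and "\<And>t. \<bar>t\<bar> \<le> \<bar>h\<bar> \<Longrightarrow> (g' has_real_derivative g'' t) (at t)"
  shows "\<exists>s t. \<bar>s\<bar> \<le> \<bar>h\<bar> \<and> \<bar>t\<bar> \<le> \<bar>h\<bar> \<and> g h + g (- h) - 2 * g 0 = h\<^sup>2 * ((g'' s + g'' t) / 2)"
proof -
  \<comment> \<open>Packs \<open>g\<close>, \<open>g'\<close>, \<open>g''\<close> into the indexed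
    family of derivatives that Maclaurin's theorem expects.\<close>
  define D where "D m = (if m = 0 then g else if m = 1 then g' else g'')" for m :: nat
  have D: "\<forall>m t. m < 2 \<and> \<bar>t\<bar> \<le> \<bar>h\<bar> \<longrightarrow> DERIV (D m) t :> D (Suc m) t"
    using assms by (auto simp: D_def less_2_cases_iff)
  obtain s where s: "\<bar>s\<bar> \<le> \<bar>h\<bar>" "g h = (\<Sum>m<2. D m 0 / fact m * h ^ m) + D 2 s / fact 2 * h ^ 2"
    using Maclaurin_bi_le[of D g 2 h] D by (auto simp: D_def)
  obtain t where t: "\<bar>t\<bar> \<le> \<bar>h\<bar>"
      "g (- h) = (\<Sum>m<2. D m 0 / fact m * (- h) ^ m) + D 2 t / fact 2 * (- h) ^ 2"
    using Maclaurin_bi_le[of D g 2 "- h"] D by (auto simp: D_def)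
  have "g h + g (- h) - 2 * g 0 = h\<^sup>2 * ((g'' s + g'' t) / 2)"
    unfolding s(2) t(2) by (simp add: D_def numeral_2_eq_2 field_simps)
  with s(1) t(1) show ?thesis by blast
qed

text \<open>The quotient is an average of two values of \<open>\<phi>''\<close> within distance
  \<open>\<bar>h\<bar> * norm i\<close> of \<open>x\<close>, so continuity at \<open>x\<close> gives
  the limit. Derivatives are assumed only for \<open>\<bar>t\<bar> < R\<close>, since the later
  \<open>\<phi>\<close> is regular only near the touching point.\<close>

lemma second_difference_tendsto:
  fixes \<phi> :: "'a::euclidean_space \<Rightarrow> real"
  assumes "R > 0"
    and "\<And>t. \<bar>t\<bar> < R \<Longrightarrow> ((\<lambda>t. \<phi> (x + t *\<^sub>R i)) has_real_derivative \<phi>' (x + t *\<^sub>R i)) (at t)"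
    and "\<And>t. \<bar>t\<bar> < R \<Longrightarrow> ((\<lambda>t. \<phi>' (x + t *\<^sub>R i)) has_real_derivative \<phi>'' (x + t *\<^sub>R i)) (at t)"
    and "isCont \<phi>'' x"
  shows "((\<lambda>h. (\<phi> (x + h *\<^sub>R i) + \<phi> (x - h *\<^sub>R i) - 2 * \<phi> x) / h\<^sup>2) \<longlongrightarrow> \<phi>'' x) (at 0)"
proof (rule tendstoI)
  fix e :: real assume e: "e > 0"
  have "isCont (\<lambda>t. \<phi>'' (x + t *\<^sub>R i)) 0"
    by (rule isCont_o2[where g=\<phi>'']) (use assms(4) in \<open>auto intro!: continuous_intros\<close>)
  then have "\<forall>\<^sub>F t in at 0. dist (\<phi>'' (x + t *\<^sub>R i)) (\<phi>'' x) < e"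
    using e unfolding isCont_def by (auto dest: tendstoD)
  then obtain d where d: "d > 0" "\<And>t. t \<noteq> 0 \<Longrightarrow> \<bar>t\<bar> < d \<Longrightarrow> \<bar>\<phi>'' (x + t *\<^sub>R i) - \<phi>'' x\<bar> < e"
    by (auto simp: eventually_at dist_real_def)
  then have d': "\<bar>\<phi>'' (x + t *\<^sub>R i) - \<phi>'' x\<bar> < e" if "\<bar>t\<bar> < d" for t
    using that e by (cases "t = 0") auto
  have "dist ((\<phi> (x + h *\<^sub>R i) + \<phi> (x - h *\<^sub>R i) - 2 * \<phi> x) / h\<^sup>2) (\<phi>'' x) < e"
    if h: "h \<noteq> 0" "\<bar>h\<bar> < min d R" for h
  proof -
    have "\<exists>s t. \<bar>s\<bar> \<le> \<bar>h\<bar> \<and> \<bar>t\<bar> \<le> \<bar>h\<bar> \<and> \<phi> (x + h *\<^sub>R i) + \<phi> (x + (- h) *\<^sub>R i) - 2 * \<phi> (x + 0 *\<^sub>R i)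
        = h\<^sup>2 * ((\<phi>'' (x + s *\<^sub>R i) + \<phi>'' (x + t *\<^sub>R i)) / 2)"
      using h by (intro second_difference_eq[where g'="\<lambda>t. \<phi>' (x + t *\<^sub>R i)"] assms(2,3)) auto
    then obtain s t where st: "\<bar>s\<bar> \<le> \<bar>h\<bar>" "\<bar>t\<bar> \<le> \<bar>h\<bar>"
        "\<phi> (x + h *\<^sub>R i) + \<phi> (x - h *\<^sub>R i) - 2 * \<phi> x = h\<^sup>2 * ((\<phi>'' (x + s *\<^sub>R i) + \<phi>'' (x + t *\<^sub>R i)) / 2)"
      by auto
    then have eq: "(\<phi> (x + h *\<^sub>R i) + \<phi> (x - h *\<^sub>R i) - 2 * \<phi> x) / h\<^sup>2 = (\<phi>'' (x + s *\<^sub>R i) + \<phi>'' (x + t *\<^sub>R i)) / 2"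
      using h(1) by simp
    have "\<bar>\<phi>'' (x + s *\<^sub>R i) - \<phi>'' x\<bar> < e" "\<bar>\<phi>'' (x + t *\<^sub>R i) - \<phi>'' x\<bar> < e"
      using st h d' by auto
    then show ?thesis
      unfolding dist_real_def eq by (simp add: abs_less_iff field_simps)
  qed
  then show "\<forall>\<^sub>F h in at 0. dist ((\<phi> (x + h *\<^sub>R i) + \<phi> (x - h *\<^sub>R i) - 2 * \<phi> x) / h\<^sup>2) (\<phi>'' x) < e"
    unfolding eventually_at using d(1) assms(1) by (intro exI[of _ "min d R"]) (auto simp: dist_real_def)
qed

section \<open>Convolution with a smooth kernel\<close>

lemma continuous_convolution:
  fixes w \<psi> :: "'a::euclidean_space \<Rightarrow> real"
  assumes w: "integrable lebesgue w" and \<psi>: "continuous_on UNIV \<psi>" "\<And>x. \<bar>\<psi> x\<bar> \<le> B"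
  shows "integrable lebesgue (\<lambda>x. w x * \<psi> (x - y))"
    and "continuous_on UNIV (\<lambda>y. LINT x|lebesgue. w x * \<psi> (x - y))"
proof -
  have shift: "continuous_on UNIV (\<lambda>x. \<psi> (x - y))" for y
    by (rule continuous_on_compose2[OF \<psi>(1)]) (auto intro!: continuous_intros)
  have meas: "(\<lambda>x. w x * \<psi> (x - y)) \<in> borel_measurable lebesgue" for y
    by (intro borel_measurable_times borel_measurable_integrable[OF w]
        measurable_lebesgue_continuous[OF shift])
  \<comment> \<open>This majorant is independent of \<open>y\<close>; it serves for integrability
    and for dominated convergence as \<open>y\<close> varies.\<close>
  have dom: "integrable lebesgue (\<lambda>x. B * \<bar>w x\<bar>)"
    using w by (intro integrable_mult_right integrable_abs)
  have bound: "norm (w x * \<psi> (x - y)) \<le> B * \<bar>w x\<bar>" for x y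
    using mult_right_mono[OF \<psi>(2)[of "x - y"], of "\<bar>w x\<bar>"] by (simp add: abs_mult mult.commute)
  then have bound': "norm (w x * \<psi> (x - y)) \<le> norm (B * \<bar>w x\<bar>)" for x y
    by (metis abs_ge_self order_trans real_norm_def)
  show "integrable lebesgue (\<lambda>x. w x * \<psi> (x - y))"
    by (rule Bochner_Integration.integrable_bound[OF dom meas AE_I2[OF bound']])
  show "continuous_on UNIV (\<lambda>y. LINT x|lebesgue. w x * \<psi> (x - y))"
  proof (rule continuous_on_sequentiallyI)
    fix f :: "nat \<Rightarrow> 'a" and a assume f: "f \<longlonglongrightarrow> a"
    show "(\<lambda>n. LINT x|lebesgue. w x * \<psi> (x - f n)) \<longlonglongrightarrow> (LINT x|lebesgue. w x * \<psi> (x - a))"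
    proof (rule integral_dominated_convergence[OF meas meas dom])
      have "(\<lambda>n. w x * \<psi> (x - f n)) \<longlonglongrightarrow> w x * \<psi> (x - a)" for x
      proof (intro tendsto_mult_left)
        have "(\<lambda>n. x - f n) \<longlonglongrightarrow> x - a"
          using f by (intro tendsto_diff tendsto_const)
        then show "(\<lambda>n. \<psi> (x - f n)) \<longlonglongrightarrow> \<psi> (x - a)"
          using \<psi>(1) by (rule_tac isCont_tendsto_compose) (simp add: continuous_on_eq_continuous_at)
      qed
      then show "AE x in lebesgue. (\<lambda>n. w x * \<psi> (x - f n)) \<longlonglongrightarrow> w x * \<psi> (x - a)"
        by simp
      show "AE x in lebesgue. norm (w x * \<psi> (x - f n)) \<le> B * \<bar>w x\<bar>" for n
        using bound by simp
    qed
  qed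
qed

text \<open>Second differences of \<open>U\<close> are integrals of \<open>w\<close> against second
  difference quotients of \<open>\<psi>\<close>, which converge pointwise and boundedly. Working
  with a sequence of differences avoids differentiating \<open>U\<close> under the integral; other
  base points are reached by shifting \<open>\<psi>\<close>.\<close>

lemma convolution_second_difference:
  fixes w :: "'a::euclidean_space \<Rightarrow> real"
  assumes w: "integrable lebesgue w" and \<psi>: "\<psi> \<in> test_functions UNIV" and i: "i \<in> Basis"
    and h: "h \<longlonglongrightarrow> 0" "\<And>n. h n \<noteq> 0"
  defines "U \<equiv> \<lambda>y. LINT x|lebesgue. w x * \<psi> (x - y)"
  shows "(\<lambda>n. (U (h n *\<^sub>R i) + U (- (h n *\<^sub>R i)) - 2 * U 0) / (h n)\<^sup>2)
    \<longlonglongrightarrow> (LINT x|lebesgue. w x * partial i (partial i \<psi>) x)"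
proof -
  let ?D = "partial i (partial i \<psi>)"
  have h0: "filterlim h (at 0) sequentially"
    using h by (auto simp: filterlim_at)
  have sm: "smooth \<psi>" "smooth (partial i \<psi>)" "smooth ?D"
    using \<psi> i by (auto simp: test_functions_def smooth_partial)
  have "\<exists>B\<ge>0. \<forall>x. norm (f x) \<le> B" if f: "f \<in> test_functions UNIV" for f :: "'a \<Rightarrow> real"
  proof -
    obtain K where K: "compact K" "\<And>x. x \<notin> K \<Longrightarrow> f x = 0"
      by (rule test_functions_support[OF f]) blast
    then show ?thesis
      using f by (intro continuous_compact_support_bounded) (auto simp: test_functions_def smooth_continuous)
  qed
  note bdd = this
  obtain C where C: "\<And>x. \<bar>\<psi> x\<bar> \<le> C"
    using bdd[OF \<psi>] by auto
  obtain B where B: "\<And>x. \<bar>?D x\<bar> \<le> B"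
    using bdd[OF test_functions_partial[OF test_functions_partial[OF \<psi> i] i]] by auto
  note int = continuous_convolution(1)[OF w smooth_continuous[OF sm(1)] C]
  define s where "s n x = w x * ((\<psi> (x + h n *\<^sub>R i) + \<psi> (x - h n *\<^sub>R i) - 2 * \<psi> x) / (h n)\<^sup>2)" for n x
  \<comment> \<open>Regroups the integrand so that each term has the form of the integrand defining
    \<open>U\<close>.\<close>
  have s_eq: "s n = (\<lambda>x. (w x * \<psi> (x - h n *\<^sub>R i) + w x * \<psi> (x - - (h n *\<^sub>R i)) - 2 * (w x * \<psi> (x - 0))) / (h n)\<^sup>2)" for n
    by (auto simp: s_def algebra_simps)
  have "(LINT x|lebesgue. s n x) = (U (h n *\<^sub>R i) + U (- (h n *\<^sub>R i)) - 2 * U 0) / (h n)\<^sup>2" for n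
    unfolding s_eq U_def by (simp only: Bochner_Integration.integral_diff Bochner_Integration.integral_add
        integral_divide_zero integral_mult_right_zero int Bochner_Integration.integrable_diff Bochner_Integration.integrable_add
        integrable_mult_right)
  moreover have "(\<lambda>n. LINT x|lebesgue. s n x) \<longlonglongrightarrow> (LINT x|lebesgue. w x * ?D x)"
  proof (rule integral_dominated_convergence[where w="\<lambda>x. B * \<bar>w x\<bar>"])
    show "(\<lambda>x. w x * ?D x) \<in> borel_measurable lebesgue"
      by (intro borel_measurable_times borel_measurable_integrable[OF w]
          measurable_lebesgue_continuous smooth_continuous sm)
    show "s n \<in> borel_measurable lebesgue" for n
      unfolding s_eq by (intro borel_measurable_divide borel_measurable_diff borel_measurable_add
          borel_measurable_times[OF borel_measurable_const] borel_measurable_integrable[OF int] borel_measurable_const)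
    show "integrable lebesgue (\<lambda>x. B * \<bar>w x\<bar>)"
      using w by (intro integrable_mult_right integrable_abs)
    have "(\<lambda>n. s n x) \<longlonglongrightarrow> w x * ?D x" for x
      unfolding s_def
    proof (intro tendsto_mult_left filterlim_compose[OF second_difference_tendsto h0])
      show "(0::real) < 1" by simp
      show "((\<lambda>t. \<psi> (x + t *\<^sub>R i)) has_real_derivative partial i \<psi> (x + t *\<^sub>R i)) (at t)" for t
        by (rule partial_along_line[OF sm(1)])
      show "((\<lambda>t. partial i \<psi> (x + t *\<^sub>R i)) has_real_derivative ?D (x + t *\<^sub>R i)) (at t)" for t
        by (rule partial_along_line[OF sm(2)])
      show "isCont ?D x"
        using smooth_continuous[OF sm(3), of UNIV] by (simp add: continuous_on_eq_continuous_at)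
    qed
    then show "AE x in lebesgue. (\<lambda>n. s n x) \<longlonglongrightarrow> w x * ?D x"
      by simp
    have "norm (s n x) \<le> B * \<bar>w x\<bar>" for n x
    proof -
      \<comment> \<open>Taylor's formula bounds the quotient by an average of two values of
        \<open>?D\<close>, hence by \<open>B\<close> uniformly in \<open>n\<close> and
        \<open>x\<close>.\<close>
      have "\<exists>a b. \<bar>a\<bar> \<le> \<bar>h n\<bar> \<and> \<bar>b\<bar> \<le> \<bar>h n\<bar> \<and> \<psi> (x + h n *\<^sub>R i) + \<psi> (x + (- h n) *\<^sub>R i) - 2 * \<psi> (x + 0 *\<^sub>R i)
          = (h n)\<^sup>2 * ((?D (x + a *\<^sub>R i) + ?D (x + b *\<^sub>R i)) / 2)"
        by (intro second_difference_eq[where g'="\<lambda>t. partial i \<psi> (x + t *\<^sub>R i)"] partial_along_line sm)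
      then obtain a b where "(\<psi> (x + h n *\<^sub>R i) + \<psi> (x - h n *\<^sub>R i) - 2 * \<psi> x) / (h n)\<^sup>2
          = (?D (x + a *\<^sub>R i) + ?D (x + b *\<^sub>R i)) / 2"
        using h(2)[of n] by auto
      moreover have "\<bar>?D (x + a *\<^sub>R i)\<bar> \<le> B" "\<bar>?D (x + b *\<^sub>R i)\<bar> \<le> B"
        using B by auto
      ultimately have "\<bar>(\<psi> (x + h n *\<^sub>R i) + \<psi> (x - h n *\<^sub>R i) - 2 * \<psi> x) / (h n)\<^sup>2\<bar> \<le> B"
        by (simp only: abs_le_iff) (simp add: field_simps)
      from mult_right_mono[OF this, of "\<bar>w x\<bar>"] show ?thesis
        unfolding s_def real_norm_def abs_mult[of "w x"] by (simp only: mult.commute abs_ge_zero)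
    qed
    then show "AE x in lebesgue. norm (s n x) \<le> B * \<bar>w x\<bar>" for n
      by simp
  qed
  ultimately show ?thesis by simp
qed

text \<open>On the ball of half the radius the bump is at least \<open>?c\<close>, its value on the
  bounding sphere, and that ball has positive measure.\<close>

lemma bump_integral_pos:
  assumes "\<delta> > 0"
  shows "(LINT x|lebesgue. bump y \<delta> x) > 0"
proof -
  let ?c = "flat_exp 0 (\<delta>\<^sup>2 - (\<delta> / 2)\<^sup>2)"
  have sq: "\<delta>\<^sup>2 - (\<delta> / 2)\<^sup>2 > 0"
    using assms by (simp add: power_divide field_simps)
  then have c: "?c > 0"
    by (simp add: flat_exp_def)
  have le: "?c * indicator (cball y (\<delta> / 2)) x \<le> bump y \<delta> x" for x
  proof (cases "x \<in> cball y (\<delta> / 2)")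
    case True
    then have "(norm (x - y))\<^sup>2 \<le> (\<delta> / 2)\<^sup>2"
      by (intro power_mono) (auto simp: dist_norm norm_minus_commute)
    then have "\<delta>\<^sup>2 - (\<delta> / 2)\<^sup>2 \<le> \<delta>\<^sup>2 - (norm (x - y))\<^sup>2" by simp
    with sq have "?c \<le> bump y \<delta> x"
      by (auto simp: bump_def flat_exp_def le_imp_inverse_le)
    with True show ?thesis by simp
  qed (simp add: bump_nonneg)
  have fin: "emeasure lebesgue (cball y (\<delta> / 2)) < \<infinity>"
    using emeasure_lborel_cball_finite[of y "\<delta> / 2"] by simp
  have "0 < ?c * measure lebesgue (cball y (\<delta> / 2))"
    using c assms by (intro mult_pos_pos) (auto simp: content_cball_pos)
  also have "\<dots> = (LINT x|lebesgue. ?c * indicator (cball y (\<delta> / 2)) x)"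
    by simp
  also have "\<dots> \<le> (LINT x|lebesgue. bump y \<delta> x)"
  proof (rule integral_mono[OF _ _ le])
    show "integrable lebesgue (\<lambda>x. ?c * indicator (cball y (\<delta> / 2)) x)"
      by (intro integrable_mult_right integrable_real_indicator fin) simp
    show "integrable lebesgue (bump y \<delta>)"
      by (rule integrable_compact_support[OF smooth_continuous[OF smooth_bump] compact_cball[of y \<delta>]])
        (use bump_nonzero_iff[OF assms, of y] in force)
  qed
  finally show ?thesis .
qed

text \<open>Mollifying \<open>u\<close> gives functions that are classical subsolutions up to a small error. The maximum
  of mollified \<open>u\<close> minus \<open>\<phi> + \<epsilon> |x - x0|\<^sup>2\<close> near \<open>x0\<close> is interior, and there the second differences
  compare.\<close>

lemma distributional_subsolution_touching:
  fixes u g \<phi> :: "'a::euclidean_space \<Rightarrow> real"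
  assumes \<Omega>: "open \<Omega>" "x0 \<in> \<Omega>" and u: "continuous_on \<Omega> u" and g: "continuous_on \<Omega> g"
    and sub: "\<And>\<psi>. \<psi> \<in> test_functions \<Omega> \<Longrightarrow> (\<And>x. \<psi> x \<ge> 0) \<Longrightarrow>
        - (LINT x:\<Omega>|lebesgue. u x * laplacian \<psi> x) \<le> (LINT x:\<Omega>|lebesgue. g x * \<psi> x)"
    and R: "R > 0" "ball x0 R \<subseteq> \<Omega>"
    and touch: "\<And>x. x \<in> ball x0 R \<Longrightarrow> u x \<le> \<phi> x" "u x0 = \<phi> x0"
    and \<phi>: "continuous_on (ball x0 R) \<phi>"
    and \<phi>': "\<And>y t i. i \<in> Basis \<Longrightarrow> y + t *\<^sub>R i \<in> ball x0 R \<Longrightarrow>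
        ((\<lambda>t. \<phi> (y + t *\<^sub>R i)) has_real_derivative \<phi>' i (y + t *\<^sub>R i)) (at t)"
    and \<phi>'': "\<And>y t i. i \<in> Basis \<Longrightarrow> y + t *\<^sub>R i \<in> ball x0 R \<Longrightarrow>
        ((\<lambda>t. \<phi>' i (y + t *\<^sub>R i)) has_real_derivative \<phi>'' i (y + t *\<^sub>R i)) (at t)"
    and \<phi>c: "\<And>i. i \<in> Basis \<Longrightarrow> continuous_on (ball x0 R) (\<phi>'' i)"
  shows "- (\<Sum>i\<in>Basis. \<phi>'' i x0) \<le> g x0"
proof (rule ccontr)
  define L where "L y = (\<Sum>i\<in>Basis. \<phi>'' i y)" for y
  assume "\<not> ?thesis"
  then have gap: "g x0 < - L x0" by (simp add: L_def)
  \<comment> \<open>Three errors of size \<open>e\<close> will accumulate: the oscillation of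
    \<open>L\<close>, the oscillation of \<open>g\<close> and the quadratic penalty. A quarter of
    the gap leaves room for all three.\<close>
  define e where "e = (- L x0 - g x0) / 4"
  have e: "e > 0" using gap by (simp add: e_def)
  \<comment> \<open>Chosen so that the Laplacian of the penalty,
    \<open>2 * \<epsilon> * DIM('a)\<close>, equals \<open>e\<close>.\<close>
  define \<epsilon> where "\<epsilon> = e / (2 * DIM('a))"
  have \<epsilon>: "\<epsilon> > 0" using e by (simp add: \<epsilon>_def)
  have "continuous_on (ball x0 R) L"
    unfolding L_def by (intro continuous_on_sum \<phi>c)
  then have "isCont L x0"
    using R(1) by (simp add: continuous_on_eq_continuous_at)
  then obtain r1 where r1: "r1 > 0" "\<And>y. dist y x0 < r1 \<Longrightarrow> \<bar>L y - L x0\<bar> < e"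
    using e unfolding continuous_at_eps_delta by (auto simp: dist_real_def)
  have "isCont g x0"
    using g \<Omega> by (simp add: continuous_on_eq_continuous_at)
  then obtain r2 where r2: "r2 > 0" "\<And>y. dist y x0 < r2 \<Longrightarrow> \<bar>g y - g x0\<bar> < e"
    using e unfolding continuous_at_eps_delta by (auto simp: dist_real_def)
  \<comment> \<open>Centres range over radius \<open>r\<close> and kernels have radius at most
    \<open>r\<close>, so everything happens within \<open>2 * r\<close>; dividing by 3 keeps this
    strictly below the three given radii.\<close>
  define r where "r = min R (min r1 r2) / 3"
  have r: "r > 0" "2 * r < R" "2 * r < r1" "2 * r < r2"
    using R(1) r1(1) r2(1) by (auto simp: r_def)
  let ?B = "cball x0 (2 * r)"
  have BR: "?B \<subseteq> ball x0 R" and B\<Omega>: "?B \<subseteq> \<Omega>"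
    using r(2) R(2) by auto
  have uB: "continuous_on ?B u"
    using u B\<Omega> by (rule continuous_on_subset)
  \<comment> \<open>The penalty on the sphere of radius \<open>r\<close> is
    \<open>\<epsilon> * r\<^sup>2\<close>. A third of it as mollification error, incurred once at
    the centre and once on the sphere, still leaves a third.\<close>
  have \<eta>: "\<epsilon> * r\<^sup>2 / 3 > 0"
    using \<epsilon> r(1) by simp
  obtain \<delta>0 where \<delta>0: "\<delta>0 > 0"
      "\<And>x y. x \<in> ?B \<Longrightarrow> y \<in> ?B \<Longrightarrow> dist x y < \<delta>0 \<Longrightarrow> \<bar>u x - u y\<bar> < \<epsilon> * r\<^sup>2 / 3"
    using compact_uniformly_continuous[OF uB compact_cball] \<eta>
    unfolding uniformly_continuous_on_def dist_real_def by metis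
  define \<delta> where "\<delta> = min r (\<delta>0 / 2)"
  have \<delta>: "\<delta> > 0" "\<delta> \<le> r" "\<delta> < \<delta>0"
    using r(1) \<delta>0(1) by (auto simp: \<delta>_def)
  have sub_ball: "cball y \<delta> \<subseteq> ?B" if "y \<in> cball x0 r" for y
    using that \<delta>(2) by (simp add: cball_subset_cball_iff dist_commute)
  \<comment> \<open>Cutting \<open>u\<close> off outside \<open>?B\<close> makes it integrable on
    the whole space without changing it on the supports of the kernels in use.\<close>
  define w where "w x = indicat_real ?B x *\<^sub>R u x" for x
  have w: "integrable lebesgue w"
    using continuous_L1_loc[OF u] B\<Omega> compact_cball
    unfolding w_def L1_loc_def set_integrable_def by blast
  define M where "M = (LINT x|lebesgue. bump (0::'a) \<delta> x)"
  have M: "M > 0"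
    unfolding M_def by (rule bump_integral_pos[OF \<delta>(1)])
  have bump_shift: "bump y \<delta> x = bump 0 \<delta> (x - y)" for x y :: 'a
    using bump_translate[of 0 y \<delta> x] by simp
  have My: "(LINT x|lebesgue. bump y \<delta> x) = M" for y :: 'a
    unfolding M_def bump_shift[of y]
    using integral_translate[OF smooth_continuous[OF smooth_bump], of "0::'a" \<delta> "- y"] by simp
  have bump_int: "integrable lebesgue (bump y \<delta>)" for y :: 'a
    by (rule integrable_compact_support[OF smooth_continuous[OF smooth_bump] compact_cball[of y \<delta>]])
      (use bump_nonzero_iff[OF \<delta>(1), of y] in force)
  obtain C where C: "\<And>x::'a. \<bar>bump 0 \<delta> x\<bar> \<le> C"
  proof -
    have "\<exists>B\<ge>0. \<forall>x::'a. norm (bump 0 \<delta> x) \<le> B"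
      by (rule continuous_compact_support_bounded[OF smooth_continuous[OF smooth_bump] compact_cball[of 0 \<delta>]])
        (use bump_nonzero_iff[OF \<delta>(1), of "0::'a"] in force)
    then show ?thesis using that by auto
  qed
  define U where "U y = (LINT x|lebesgue. w x * bump 0 \<delta> (x - y))" for y
  note wint = continuous_convolution(1)[OF w smooth_continuous[OF smooth_bump] C]
  have U_cont: "continuous_on UNIV U"
    unfolding U_def by (rule continuous_convolution(2)[OF w smooth_continuous[OF smooth_bump] C])
  have U_close: "\<bar>U y - M * u y\<bar> \<le> M * (\<epsilon> * r\<^sup>2 / 3)" if y: "y \<in> cball x0 r" for y
  proof -
    have int: "integrable lebesgue (\<lambda>x. w x * bump y \<delta> x)"
      unfolding bump_shift[of y] by (rule wint)
    \<comment> \<open>Since the kernel has mass \<open>M\<close>, the error is the integral of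
      \<open>w x - u y\<close> against it, and its support lies within the modulus of uniform
      continuity.\<close>
    have "U y - M * u y = (LINT x|lebesgue. w x * bump y \<delta> x - u y * bump y \<delta> x)"
      using int bump_int My[of y] by (simp add: U_def bump_shift[of y, symmetric])
    also have "\<bar>\<dots>\<bar> \<le> (LINT x|lebesgue. \<epsilon> * r\<^sup>2 / 3 * bump y \<delta> x)"
    proof (rule order_trans[OF integral_abs_bound integral_mono])
      show "integrable lebesgue (\<lambda>x. \<bar>w x * bump y \<delta> x - u y * bump y \<delta> x\<bar>)"
        by (intro integrable_abs Bochner_Integration.integrable_diff int integrable_mult_right bump_int)
      show "integrable lebesgue (\<lambda>x. \<epsilon> * r\<^sup>2 / 3 * bump y \<delta> x)"
        by (intro integrable_mult_right bump_int)
      show "\<bar>w x * bump y \<delta> x - u y * bump y \<delta> x\<bar> \<le> \<epsilon> * r\<^sup>2 / 3 * bump y \<delta> x" for x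
      proof (cases "x \<in> ball y \<delta>")
        case True
        then have "x \<in> cball y \<delta>" "dist x y < \<delta>0"
          using \<delta>(3) by (auto simp: dist_commute)
        then have "x \<in> ?B" "y \<in> ?B" "dist x y < \<delta>0"
          using sub_ball[OF y] y r(1) by auto
        then have "\<bar>w x - u y\<bar> \<le> \<epsilon> * r\<^sup>2 / 3"
          using \<delta>0(2)[of x y] by (simp add: w_def)
        then have "\<bar>w x - u y\<bar> * bump y \<delta> x \<le> \<epsilon> * r\<^sup>2 / 3 * bump y \<delta> x"
          by (rule mult_right_mono) (rule bump_nonneg)
        moreover have "\<bar>w x * bump y \<delta> x - u y * bump y \<delta> x\<bar> = \<bar>w x - u y\<bar> * bump y \<delta> x"
          by (simp only: left_diff_distrib[symmetric] abs_mult abs_of_nonneg[OF bump_nonneg])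
        ultimately show ?thesis by simp
      next
        case False
        then have "bump y \<delta> x = 0"
          using bump_nonzero_iff[OF \<delta>(1)] by blast
        then show ?thesis by simp
      qed
    qed
    also have "\<dots> = M * (\<epsilon> * r\<^sup>2 / 3)"
      using My[of y] by simp
    finally show ?thesis .
  qed
  define H where "H y = U y - M * (\<phi> y + \<epsilon> * (norm (y - x0))\<^sup>2)" for y
  have small: "cball x0 r \<subseteq> ball x0 R"
    using r by auto
  have "continuous_on (cball x0 r) H"
    unfolding H_def
    by (intro continuous_intros continuous_on_subset[OF U_cont] continuous_on_subset[OF \<phi> small]) auto
  then obtain y0 where y0: "y0 \<in> cball x0 r" "\<And>y. y \<in> cball x0 r \<Longrightarrow> H y \<le> H y0"
    using continuous_attains_sup[OF compact_cball, of x0 r H] r(1) by auto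
  \<comment> \<open>In units of \<open>M * (\<epsilon> * r\<^sup>2 / 3)\<close>, \<open>H\<close> is
    at most -2 on the sphere and at least -1 at the centre, so the maximum is interior.\<close>
  have y0_in: "dist x0 y0 < r"
  proof (rule ccontr)
    assume "\<not> dist x0 y0 < r"
    then have "norm (y0 - x0) = r"
      using y0(1) by (simp add: dist_norm norm_minus_commute)
    then have "H y0 = U y0 - M * \<phi> y0 - 3 * (M * (\<epsilon> * r\<^sup>2 / 3))"
      by (simp add: H_def algebra_simps)
    moreover have "U y0 \<le> M * u y0 + M * (\<epsilon> * r\<^sup>2 / 3)"
      using U_close[OF y0(1)] by linarith
    moreover have "M * u y0 \<le> M * \<phi> y0"
      using touch(1)[of y0] y0(1) small M by (intro mult_left_mono) auto
    moreover have "H x0 = U x0 - M * u x0"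
      using touch(2) by (simp add: H_def)
    moreover have "U x0 - M * u x0 \<ge> - (M * (\<epsilon> * r\<^sup>2 / 3))"
      using U_close[of x0] r(1) by (simp only: centre_in_cball) linarith
    moreover have "H x0 \<le> H y0"
      using y0(2) r(1) by simp
    moreover have "M * (\<epsilon> * r\<^sup>2 / 3) > 0"
      using M \<eta> by (rule mult_pos_pos)
    ultimately show False by linarith
  qed
  define \<psi> where "\<psi> = bump y0 \<delta>"
  have \<psi>_test: "\<psi> \<in> test_functions S" if "?B \<subseteq> S" for S
    unfolding \<psi>_def using sub_ball[OF y0(1)] that by (intro bump_test_function \<delta>) auto
  \<comment> \<open>At an interior maximum of \<open>H\<close>, the second differences of
    \<open>U\<close> are at most those of \<open>M\<close> times the penalised
    \<open>\<phi>\<close>; the penalty contributes exactly \<open>2 * \<epsilon>\<close>.\<close>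
  have D_le: "(LINT x|lebesgue. w x * partial i (partial i \<psi>) x) \<le> M * (\<phi>'' i y0 + 2 * \<epsilon>)"
    if i: "i \<in> Basis" for i
  proof -
    define \<rho> where "\<rho> = r - dist x0 y0"
    have \<rho>: "\<rho> > 0" using y0_in by (simp add: \<rho>_def)
    \<comment> \<open>Starting the denominators at 2 keeps \<open>\<bar>h n\<bar>\<close> strictly
      below \<open>\<rho>\<close>, also for \<open>n = 0\<close>.\<close>
    define h where "h n = \<rho> / real (Suc (Suc n))" for n
    have h: "h n \<noteq> 0" "\<bar>h n\<bar> < \<rho>" for n
      using \<rho> by (auto simp: h_def divide_less_eq)
    have h_lim: "h \<longlonglongrightarrow> 0"
      unfolding h_def by (intro LIMSEQ_Suc lim_const_over_n)
    have h0: "filterlim h (at 0) sequentially"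
      using h h_lim by (auto simp: filterlim_at)
    have in_ball: "y0 + t *\<^sub>R i \<in> cball x0 r" if "\<bar>t\<bar> < \<rho>" for t
    proof -
      have "dist x0 (y0 + t *\<^sub>R i) \<le> dist x0 y0 + \<bar>t\<bar>"
        using dist_triangle[of x0 "y0 + t *\<^sub>R i" y0] i by (simp add: dist_norm)
      then show ?thesis using that by (simp add: \<rho>_def)
    qed
    \<comment> \<open>Recentres at \<open>y0\<close>: with \<open>\<psi>\<close> as kernel,
      increments of \<open>U\<close> at \<open>y0\<close> become increments at the origin.\<close>
    have U_eq: "U (y0 + a) = (LINT x|lebesgue. w x * \<psi> (x - a))" for a
      by (simp add: U_def \<psi>_def bump_shift[of y0] algebra_simps)
    have lim1: "(\<lambda>n. (U (y0 + h n *\<^sub>R i) + U (y0 + - (h n *\<^sub>R i)) - 2 * U (y0 + 0)) / (h n)\<^sup>2)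
        \<longlonglongrightarrow> (LINT x|lebesgue. w x * partial i (partial i \<psi>) x)"
      unfolding U_eq by (rule convolution_second_difference[OF w \<psi>_test i h_lim h(1)]) simp
    have lim2: "(\<lambda>n. (\<phi> (y0 + h n *\<^sub>R i) + \<phi> (y0 - h n *\<^sub>R i) - 2 * \<phi> y0) / (h n)\<^sup>2) \<longlonglongrightarrow> \<phi>'' i y0"
    proof (rule filterlim_compose[OF second_difference_tendsto[OF \<rho>] h0])
      show "((\<lambda>t. \<phi> (y0 + t *\<^sub>R i)) has_real_derivative \<phi>' i (y0 + t *\<^sub>R i)) (at t)" if "\<bar>t\<bar> < \<rho>" for t
        using in_ball[OF that] small by (intro \<phi>' i) auto
      show "((\<lambda>t. \<phi>' i (y0 + t *\<^sub>R i)) has_real_derivative \<phi>'' i (y0 + t *\<^sub>R i)) (at t)" if "\<bar>t\<bar> < \<rho>" for t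
        using in_ball[OF that] small by (intro \<phi>'' i) auto
      show "isCont (\<phi>'' i) y0"
        using \<phi>c[OF i] y0(1) small by (auto simp: continuous_on_eq_continuous_at)
    qed
    have lim3: "(\<lambda>n. M * ((\<phi> (y0 + h n *\<^sub>R i) + \<phi> (y0 - h n *\<^sub>R i) - 2 * \<phi> y0) / (h n)\<^sup>2 + 2 * \<epsilon>))
        \<longlonglongrightarrow> M * (\<phi>'' i y0 + 2 * \<epsilon>)"
      by (intro tendsto_intros lim2)
    have le: "(U (y0 + h n *\<^sub>R i) + U (y0 + - (h n *\<^sub>R i)) - 2 * U (y0 + 0)) / (h n)\<^sup>2
        \<le> M * ((\<phi> (y0 + h n *\<^sub>R i) + \<phi> (y0 - h n *\<^sub>R i) - 2 * \<phi> y0) / (h n)\<^sup>2 + 2 * \<epsilon>)" for n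
    proof -
      let ?a = "h n *\<^sub>R i"
      have "H (y0 + ?a) \<le> H y0" "H (y0 - ?a) \<le> H y0"
        using in_ball[of "h n"] in_ball[of "- h n"] h(2)[of n] y0(2) by auto
      \<comment> \<open>The parallelogram law makes the second difference of the squared norm
        independent of the base point.\<close>
      moreover have "(norm (y0 + ?a - x0))\<^sup>2 + (norm (y0 - ?a - x0))\<^sup>2 = 2 * (norm (y0 - x0))\<^sup>2 + 2 * (h n)\<^sup>2"
      proof -
        have "(norm ?a)\<^sup>2 = (h n)\<^sup>2"
          using i by simp
        then show ?thesis
          unfolding power2_norm_eq_inner by (simp add: inner_diff inner_add inner_commute algebra_simps)
      qed
      ultimately have "U (y0 + ?a) + U (y0 - ?a) - 2 * U y0
          \<le> M * (\<phi> (y0 + ?a) + \<phi> (y0 - ?a) - 2 * \<phi> y0) + M * \<epsilon> * (2 * (h n)\<^sup>2)"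
        unfolding H_def by (simp add: algebra_simps) (smt (verit, best) distrib_left)
      moreover have "M * (A / q + 2 * \<epsilon>) * q = M * A + M * \<epsilon> * (2 * q)" if "q > 0" for A q :: real
        using that by (simp add: field_simps)
      moreover have "(h n)\<^sup>2 > 0"
        using h(1)[of n] by simp
      ultimately show ?thesis
        by (simp add: pos_divide_le_eq)
    qed
    show ?thesis
      by (rule LIMSEQ_le[OF lim1 lim3]) (use le in blast)
  qed
  have int_D: "integrable lebesgue (\<lambda>x. w x * partial i (partial i \<psi>) x)" if i: "i \<in> Basis" for i
  proof -
    have t: "partial i (partial i \<psi>) \<in> test_functions UNIV"
      by (intro test_functions_partial i \<psi>_test) simp
    obtain K where K: "compact K" "K \<subseteq> UNIV" "\<And>x. x \<notin> K \<Longrightarrow> partial i (partial i \<psi>) x = 0"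
      by (rule test_functions_support[OF t]) blast
    have c: "continuous_on UNIV (partial i (partial i \<psi>))"
      using t by (intro smooth_continuous) (simp add: test_functions_def)
    obtain D where "\<And>x. \<bar>partial i (partial i \<psi>) x\<bar> \<le> D"
      using continuous_compact_support_bounded[OF c K(1,3)] by auto
    from continuous_convolution(1)[OF w c this, of 0] show ?thesis by simp
  qed
  have "(LINT x:\<Omega>|lebesgue. u x * laplacian \<psi> x)
      = (LINT x|lebesgue. (\<Sum>i\<in>Basis. w x * partial i (partial i \<psi>) x))"
  proof -
    have "indicat_real \<Omega> x *\<^sub>R (u x * laplacian \<psi> x) = (\<Sum>i\<in>Basis. w x * partial i (partial i \<psi>) x)" for x
    proof (cases "x \<in> ?B")
      case True
      then show ?thesis
        using B\<Omega> by (auto simp: w_def laplacian_def sum_distrib_left)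
    next
      case False
      have "partial i (partial i \<psi>) x = 0" if i: "i \<in> Basis" for i
      proof -
        \<comment> \<open>Membership for the closed ball \<open>?B\<close> in place of
          \<open>\<Omega>\<close> records that the support lies in \<open>?B\<close>.\<close>
        have "partial i (partial i \<psi>) \<in> test_functions ?B"
          by (intro test_functions_partial i \<psi>_test) simp
        then show ?thesis
          using False closure_subset[of "{x. partial i (partial i \<psi>) x \<noteq> 0}"]
          unfolding test_functions_def by blast
      qed
      then show ?thesis
        by (simp add: laplacian_def)
    qed
    then show ?thesis
      unfolding set_lebesgue_integral_def by (simp only:)
  qed
  also have "\<dots> = (\<Sum>i\<in>Basis. LINT x|lebesgue. w x * partial i (partial i \<psi>) x)"
    using int_D by (rule Bochner_Integration.integral_sum)
  also have "\<dots> \<le> (\<Sum>i\<in>Basis. M * (\<phi>'' i y0 + 2 * \<epsilon>))"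
    by (intro sum_mono D_le)
  also have "\<dots> = M * (L y0 + real DIM('a) * (2 * \<epsilon>))"
    by (simp add: L_def sum.distrib sum_distrib_left[symmetric])
  also have "real DIM('a) * (2 * \<epsilon>) = e"
    by (simp add: \<epsilon>_def)
  finally have upper: "(LINT x:\<Omega>|lebesgue. u x * laplacian \<psi> x) \<le> M * (L y0 + e)" .
  have "(LINT x:\<Omega>|lebesgue. g x * \<psi> x) \<le> (LINT x|lebesgue. (g x0 + e) * \<psi> x)"
    unfolding set_lebesgue_integral_def
  proof (rule integral_mono)
    have "integrable lebesgue (\<lambda>x. \<psi> x *\<^sub>R g x)"
    proof (rule integrable_mult_compact_support[OF continuous_L1_loc[OF g]])
      show "continuous_on UNIV \<psi>"
        unfolding \<psi>_def by (intro smooth_continuous smooth_bump)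
      show "cball y0 \<delta> \<subseteq> \<Omega>"
        using sub_ball[OF y0(1)] B\<Omega> by blast
      show "\<psi> x = 0" if "x \<notin> cball y0 \<delta>" for x
        using bump_nonzero_iff[OF \<delta>(1), of y0 x] that unfolding \<psi>_def by force
    qed simp
    then have "integrable lebesgue (\<lambda>x. g x * \<psi> x)"
      by (simp add: mult.commute)
    then show "integrable lebesgue (\<lambda>x. indicat_real \<Omega> x *\<^sub>R (g x * \<psi> x))"
      using \<Omega>(1) by (intro integrable_mult_indicator) auto
    show "integrable lebesgue (\<lambda>x. (g x0 + e) * \<psi> x)"
      unfolding \<psi>_def by (intro integrable_mult_right bump_int)
    fix x
    show "indicat_real \<Omega> x *\<^sub>R (g x * \<psi> x) \<le> (g x0 + e) * \<psi> x"
    proof (cases "x \<in> ball y0 \<delta>")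
      case True
      then have "x \<in> ?B"
        using sub_ball[OF y0(1)] ball_subset_cball by blast
      then have "\<bar>g x - g x0\<bar> < e" "x \<in> \<Omega>"
        using r2(2)[of x] r(4) B\<Omega> by (auto simp: dist_commute)
      then show ?thesis
        using mult_right_mono[of "g x" "g x0 + e" "\<psi> x"] bump_nonneg[of y0 \<delta> x] unfolding \<psi>_def by simp
    next
      case False
      then have "\<psi> x = 0"
        unfolding \<psi>_def using bump_nonzero_iff[OF \<delta>(1)] by blast
      then show ?thesis by simp
    qed
  qed
  also have "\<dots> = M * (g x0 + e)"
    using My[of y0] by (simp add: \<psi>_def mult.commute)
  finally have lower: "(LINT x:\<Omega>|lebesgue. g x * \<psi> x) \<le> M * (g x0 + e)" .
  have "- (LINT x:\<Omega>|lebesgue. u x * laplacian \<psi> x) \<le> (LINT x:\<Omega>|lebesgue. g x * \<psi> x)"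
    by (rule sub[OF \<psi>_test[OF B\<Omega>]]) (simp add: \<psi>_def bump_nonneg)
  with upper lower have "0 \<le> M * (L y0 + e) + M * (g x0 + e)"
    by linarith
  then have "0 \<le> M * (L y0 + g x0 + 2 * e)"
    by (simp add: algebra_simps)
  then have "0 \<le> L y0 + g x0 + 2 * e"
    using M by (simp add: zero_le_mult_iff)
  moreover have "\<bar>L y0 - L x0\<bar> < e"
    using y0_in r by (intro r1(2)) (simp add: dist_commute)
  moreover have "L x0 + g x0 = - 4 * e"
    by (simp add: e_def)
  ultimately show False
    using e by (simp add: abs_less_iff)
qed

subsection \<open>The distance to the boundary\<close>

text \<open>Take a supporting hyperplane at a boundary point \<open>p\<close> nearest to
  \<open>x0\<close>. The segment from \<open>x\<close> to its projection onto the hyperplane leaves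
  \<open>\<Omega>\<close>, so it meets the frontier and its length bounds the distance. At
  \<open>x0\<close> the Cauchy-Schwarz inequality gives the converse.\<close>

lemma boundary_dist_support:
  fixes \<Omega> :: "'a::euclidean_space set"
  assumes \<Omega>: "open \<Omega>" "convex \<Omega>" "frontier \<Omega> \<noteq> {}" and x0: "x0 \<in> \<Omega>"
  obtains a b where "norm a = 1" "\<And>x. x \<in> \<Omega> \<Longrightarrow> boundary_dist \<Omega> x \<le> x \<bullet> a - b"
    "boundary_dist \<Omega> x0 = x0 \<bullet> a - b"
proof -
  obtain p where p: "p \<in> frontier \<Omega>" "boundary_dist \<Omega> x0 = dist x0 p"
    using infdist_attains_inf[OF frontier_closed \<Omega>(3)] unfolding boundary_dist_def by metis
  have "p \<in> closure \<Omega>" "p \<notin> rel_interior \<Omega>"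
    using p(1) \<Omega>(1) by (auto simp: frontier_def rel_interior_open interior_open)
  then obtain a' where a': "a' \<noteq> 0" "\<And>y. y \<in> rel_interior \<Omega> \<Longrightarrow> a' \<bullet> p < a' \<bullet> y"
    using supporting_hyperplane_relative_frontier[OF \<Omega>(2)] by metis
  define a where "a = a' /\<^sub>R norm a'"
  have a: "norm a = 1"
    using a'(1) by (simp add: a_def)
  have pos: "p \<bullet> a < x \<bullet> a" if "x \<in> \<Omega>" for x
  proof -
    have "a' \<bullet> p < a' \<bullet> x"
      using a'(2)[of x] that \<Omega>(1) by (simp add: rel_interior_open)
    then have "(a' \<bullet> p) / norm a' < (a' \<bullet> x) / norm a'"
      using a'(1) by (intro divide_strict_right_mono) auto
    then show ?thesis
      by (simp add: a_def inner_commute divide_inverse_commute)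
  qed
  have le: "boundary_dist \<Omega> x \<le> x \<bullet> a - p \<bullet> a" if x: "x \<in> \<Omega>" for x
  proof -
    define z where "z = x - (x \<bullet> a - p \<bullet> a) *\<^sub>R a"
    have "z \<bullet> a = p \<bullet> a"
      using a by (simp add: z_def inner_diff_left norm_eq_1)
    then have "z \<notin> \<Omega>"
      using pos by force
    then have "closed_segment x z \<inter> frontier \<Omega> \<noteq> {}"
      using x by (intro connected_Int_frontier connected_segment) auto
    then obtain q where q: "q \<in> closed_segment x z" "q \<in> frontier \<Omega>"
      by blast
    have "boundary_dist \<Omega> x \<le> dist x q"
      unfolding boundary_dist_def using q(2) by (rule infdist_le)
    also have "\<dots> \<le> norm (z - x)"
      using segment_bound(1)[OF q(1)] by (simp add: dist_norm norm_minus_commute)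
    also have "\<dots> = x \<bullet> a - p \<bullet> a"
      using a pos[OF x] by (simp add: z_def)
    finally show ?thesis .
  qed
  have "x0 \<bullet> a - p \<bullet> a \<le> norm (x0 - p) * norm a"
    using norm_cauchy_schwarz[of "x0 - p" a] by (simp add: inner_diff_left)
  then have "boundary_dist \<Omega> x0 = x0 \<bullet> a - p \<bullet> a"
    using le[OF x0] p(2) a by (simp add: dist_norm)
  with a le that show ?thesis by blast
qed

section \<open>The exponent and the boundary condition\<close>

text \<open>\<open>\<beta>\<close> is the smaller root of
  \<open>\<beta> * (1 - \<beta>) = \<kappa>\<close>, which says that \<open>t powr \<beta>\<close>
  solves \<open>- f'' = \<kappa> * f / t\<^sup>2\<close> on the half-line.\<close>

lemma alpha_minus_half:
  assumes "0 < \<kappa>" "\<kappa> < 1 / 4"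
  defines "\<beta> \<equiv> alpha_minus \<kappa> / 2"
  shows "0 < \<beta>" "\<beta> * (1 - \<beta>) = \<kappa>"
proof -
  have "sqrt (1 - 4 * \<kappa>) < 1"
    using assms by simp
  then show "0 < \<beta>"
    by (simp add: \<beta>_def alpha_minus_def)
  have "(sqrt (1 - 4 * \<kappa>))\<^sup>2 = 1 - 4 * \<kappa>"
    using assms by simp
  then show "\<beta> * (1 - \<beta>) = \<kappa>"
    by (simp add: \<beta>_def alpha_minus_def power2_eq_square field_simps)
qed

text \<open>Turns the filter into a strip of width \<open>b\<close> along the boundary; the
  condition \<open>0 < boundary_dist \<Omega> x\<close> reflects that \<open>at_right 0\<close> is
  punctured.\<close>

lemma Limsup_to_boundary_leD:
  fixes f :: "'a::euclidean_space \<Rightarrow> ereal"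
  assumes "Limsup (to_boundary \<Omega>) f \<le> C" "C < y"
  obtains b where "b > 0" "\<And>x. x \<in> \<Omega> \<Longrightarrow> 0 < boundary_dist \<Omega> x \<Longrightarrow> boundary_dist \<Omega> x < b \<Longrightarrow> f x < y"
proof -
  have "\<forall>\<^sub>F x in to_boundary \<Omega>. f x < y"
    using assms by (simp add: Limsup_le_iff)
  then obtain Q where Q: "eventually Q (at_right 0)" "\<And>x. Q (boundary_dist \<Omega> x) \<Longrightarrow> x \<in> \<Omega> \<Longrightarrow> f x < y"
    by (auto simp: to_boundary_def eventually_inf_principal eventually_filtercomap)
  then show ?thesis
    using that unfolding eventually_at_right_field by metis
qed

text \<open>In a strip along the boundary the ratio stays below its value at \<open>z\<close>, so
  its maximum over the compact remainder of \<open>\<Omega>\<close> is a maximum over all of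
  \<open>\<Omega>\<close>.\<close>

lemma attains_sup_ratio:
  fixes \<Omega> :: "'a::euclidean_space set" and u v :: "'a \<Rightarrow> real"
  assumes \<Omega>: "open \<Omega>" "bounded \<Omega>" "frontier \<Omega> \<noteq> {}"
    and u: "continuous_on \<Omega> u" and v: "continuous_on \<Omega> v" "\<And>x. x \<in> \<Omega> \<Longrightarrow> v x > 0"
    and bdry: "\<And>y. y > 0 \<Longrightarrow> \<exists>b>0. \<forall>x\<in>\<Omega>. boundary_dist \<Omega> x < b \<longrightarrow> u x / v x < y"
    and z: "z \<in> \<Omega>" "u z > 0"
  obtains c x0 where "c > 0" "x0 \<in> \<Omega>" "u x0 = c * v x0" "\<And>x. x \<in> \<Omega> \<Longrightarrow> u x \<le> c * v x"
proof -
  have c0: "u z / v z > 0"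
    using z v(2) by simp
  obtain b where b: "b > 0" "\<And>x. x \<in> \<Omega> \<Longrightarrow> boundary_dist \<Omega> x < b \<Longrightarrow> u x / v x < u z / v z"
    using bdry[OF c0] by blast
  \<comment> \<open>The closure makes \<open>K\<close> compact;
    \<open>b \<le> boundary_dist \<Omega> x\<close> with \<open>b > 0\<close> excludes the frontier,
    where the distance is 0, and so puts \<open>K\<close> inside \<open>\<Omega>\<close>.\<close>
  define K where "K = closure \<Omega> \<inter> {x. b \<le> boundary_dist \<Omega> x}"
  have "closed {x. b \<le> boundary_dist \<Omega> x}"
    by (intro closed_Collect_le continuous_on_const continuous_on_boundary_dist)
  then have "compact K"
    unfolding K_def using \<Omega>(2) by (intro compact_Int_closed) (simp add: compact_closure)
  have K: "K \<subseteq> \<Omega>"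
  proof
    fix x assume x: "x \<in> K"
    then have "x \<notin> frontier \<Omega>"
      using b(1) infdist_zero[of x "frontier \<Omega>"] by (auto simp: K_def boundary_dist_def)
    with x show "x \<in> \<Omega>"
      using \<Omega>(1) by (auto simp: K_def frontier_def interior_open)
  qed
  have zK: "z \<in> K"
    using b(2)[OF z(1)] z(1) closure_subset by (fastforce simp: K_def)
  have "continuous_on K (\<lambda>x. u x / v x)"
    using K v(2) by (intro continuous_on_divide continuous_on_subset[OF u] continuous_on_subset[OF v(1)]) force+
  then obtain x0 where x0: "x0 \<in> K" "\<And>x. x \<in> K \<Longrightarrow> u x / v x \<le> u x0 / v x0"
    using continuous_attains_sup[OF \<open>compact K\<close>] zK by blast
  show ?thesis
  proof (rule that)
    show "u x0 / v x0 > 0"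
      using c0 x0(2)[OF zK] by linarith
    show x0': "x0 \<in> \<Omega>"
      using x0(1) K by blast
    then show "u x0 = u x0 / v x0 * v x0"
      using v(2)[of x0] by simp
    show "u x \<le> u x0 / v x0 * v x" if x: "x \<in> \<Omega>" for x
    proof -
      have "u x / v x \<le> u x0 / v x0"
      proof (cases "b \<le> boundary_dist \<Omega> x")
        case True
        then show ?thesis
          using x closure_subset by (intro x0(2)) (auto simp: K_def)
      next
        case False
        then show ?thesis
          using b(2)[OF x] x0(2)[OF zK] by linarith
      qed
      then show ?thesis
        using v(2)[OF x] by (simp add: pos_divide_le_eq)
    qed
  qed
qed

section \<open>Contradiction at the touching point\<close>

theorem proposition2p14:
  fixes \<Omega> :: "(real ^ 'n) set" and \<kappa> :: real and u :: "real ^ 'n \<Rightarrow> real"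
  assumes "CARD('n) \<ge> 2"
    and "open \<Omega>" and "connected \<Omega>" and "\<Omega> \<noteq> {}"
    and "bounded \<Omega>" and "convex \<Omega>" and "smooth_boundary \<Omega>"
    and "0 < \<kappa>" and "\<kappa> < 1 / 4"
    and "u \<in> H1_loc \<Omega>" and "continuous_on \<Omega> u"
    and "L_subharmonic \<kappa> \<Omega> u"
    and "Limsup (to_boundary \<Omega>)
           (\<lambda>x. ereal (u x / boundary_dist \<Omega> x powr (alpha_minus \<kappa> / 2))) \<le> 0"
  shows "\<forall>x\<in>\<Omega>. u x \<le> 0"
proof (rule ccontr)
  assume "\<not> ?thesis"
  then obtain z where z: "z \<in> \<Omega>" "u z > 0" by force
  define \<beta> where "\<beta> = alpha_minus \<kappa> / 2"
  have \<beta>: "0 < \<beta>" "\<beta> * (1 - \<beta>) = \<kappa>"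
    using alpha_minus_half[OF \<open>0 < \<kappa>\<close> \<open>\<kappa> < 1 / 4\<close>] by (auto simp: \<beta>_def)
  let ?d = "boundary_dist \<Omega>"
  \<comment> \<open>The first power solves \<open>- f'' = \<kappa> * f / t\<^sup>2\<close> exactly;
    the square root solves it with 1/4 in place of \<open>\<kappa>\<close>, which provides the
    strictness.\<close>
  define f where "f t = t powr \<beta> + t powr (1 / 2)" for t :: real
  define f1 where "f1 t = \<beta> * t powr (\<beta> - 1) + 1 / 2 * t powr (1 / 2 - 1)" for t :: real
  define f2 where "f2 t = \<beta> * ((\<beta> - 1) * t powr (\<beta> - 1 - 1))
      + 1 / 2 * ((1 / 2 - 1) * t powr (1 / 2 - 1 - 1))" for t :: real
  have f1: "(f has_real_derivative f1 t) (at t)" if "t > 0" for t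
    unfolding f_def f1_def by (intro DERIV_add has_real_derivative_powr that)
  have f2: "(f1 has_real_derivative f2 t) (at t)" if "t > 0" for t
    unfolding f1_def f2_def by (intro DERIV_add DERIV_cmult has_real_derivative_powr that)
  have fr: "frontier \<Omega> \<noteq> {}"
    using \<open>\<Omega> \<noteq> {}\<close> \<open>bounded \<Omega>\<close> by (intro frontier_not_empty) auto
  have d_pos: "?d x > 0" if "x \<in> \<Omega>" for x
    using boundary_dist_pos[OF \<open>open \<Omega>\<close> fr that] .
  have fd_cont: "continuous_on \<Omega> (\<lambda>x. f (?d x))"
    unfolding f_def using d_pos
    by (intro continuous_on_add continuous_on_powr continuous_on_boundary_dist continuous_on_const) force+
  have fd_pos: "f (?d x) > 0" if "x \<in> \<Omega>" for x
    using d_pos[OF that] by (simp add: f_def add_pos_pos)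
  \<comment> \<open>As \<open>f t\<close> dominates \<open>t powr \<beta>\<close> and
    \<open>y\<close> is positive, the bound on \<open>u / d powr \<beta>\<close> carries over to
    \<open>u / f d\<close> whatever the sign of \<open>u\<close>.\<close>
  have "\<exists>b>0. \<forall>x\<in>\<Omega>. ?d x < b \<longrightarrow> u x / f (?d x) < y" if y: "y > 0" for y :: real
  proof -
    obtain b where b: "b > 0" "\<And>x. x \<in> \<Omega> \<Longrightarrow> 0 < ?d x \<Longrightarrow> ?d x < b \<Longrightarrow> ereal (u x / ?d x powr \<beta>) < ereal y"
      by (rule Limsup_to_boundary_leD[OF assms(13)[folded \<beta>_def], of "ereal y"]) (use y in auto)
    have "u x / f (?d x) < y" if x: "x \<in> \<Omega>" "?d x < b" for x
    proof -
      have "u x < y * ?d x powr \<beta>"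
        using b(2)[OF x(1) d_pos[OF x(1)] x(2)] d_pos[OF x(1)] by (simp add: pos_divide_less_eq)
      also have "\<dots> \<le> y * f (?d x)"
        using y by (intro mult_left_mono) (auto simp: f_def)
      finally show ?thesis
        using fd_pos[OF x(1)] by (simp add: pos_divide_less_eq)
    qed
    with b(1) show ?thesis by blast
  qed
  then obtain c x0 where c: "c > 0" and x0: "x0 \<in> \<Omega>" "u x0 = c * f (?d x0)"
    and le: "\<And>x. x \<in> \<Omega> \<Longrightarrow> u x \<le> c * f (?d x)"
    using attains_sup_ratio[OF \<open>open \<Omega>\<close> \<open>bounded \<Omega>\<close> fr \<open>continuous_on \<Omega> u\<close> fd_cont fd_pos _ z] by metis
  obtain a b where a: "norm a = 1" and d_le: "\<And>x. x \<in> \<Omega> \<Longrightarrow> ?d x \<le> x \<bullet> a - b"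
    and d_eq: "?d x0 = x0 \<bullet> a - b"
    by (rule boundary_dist_support[OF \<open>open \<Omega>\<close> \<open>convex \<Omega>\<close> fr x0(1)]) blast
  obtain R where R: "R > 0" "ball x0 R \<subseteq> \<Omega>"
    using \<open>open \<Omega>\<close> x0(1) open_contains_ball by blast
  \<comment> \<open>The affine majorant inherits positivity from the distance, so the powers in
    \<open>f\<close> are differentiable throughout the ball.\<close>
  have pos: "x \<bullet> a - b > 0" if "x \<in> ball x0 R" for x
    using d_le[of x] d_pos[of x] R(2) that by force
  have line: "((\<lambda>t. (y + t *\<^sub>R i) \<bullet> a - b) has_real_derivative i \<bullet> a) (at t)" for y i t
    by (auto intro!: derivative_eq_intros simp: inner_add_left)
  have affine_cont: "continuous_on S (\<lambda>x. x \<bullet> a - b)" for S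
    by (intro continuous_intros)
  have "- (\<Sum>i\<in>Basis. c * (f2 (x0 \<bullet> a - b) * (i \<bullet> a) * (i \<bullet> a))) \<le> \<kappa> * u x0 / (?d x0)\<^sup>2"
  proof (rule distributional_subsolution_touching[where \<phi>="\<lambda>x. c * f (x \<bullet> a - b)"
        and \<phi>'="\<lambda>i x. c * (f1 (x \<bullet> a - b) * (i \<bullet> a))"
        and \<phi>''="\<lambda>i x. c * (f2 (x \<bullet> a - b) * (i \<bullet> a) * (i \<bullet> a))"])
    show "open \<Omega>" "x0 \<in> \<Omega>" "continuous_on \<Omega> u" "R > 0" "ball x0 R \<subseteq> \<Omega>"
      by fact+
    show "continuous_on \<Omega> (\<lambda>x. \<kappa> * u x / (?d x)\<^sup>2)"
      using d_pos by (intro continuous_intros \<open>continuous_on \<Omega> u\<close> continuous_on_boundary_dist) force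
    show "- (LINT x:\<Omega>|lebesgue. u x * laplacian \<psi> x) \<le> (LINT x:\<Omega>|lebesgue. \<kappa> * u x / (?d x)\<^sup>2 * \<psi> x)"
      if "\<psi> \<in> test_functions \<Omega>" "\<And>x. \<psi> x \<ge> 0" for \<psi>
      by (rule L_subharmonic_distributional[OF \<open>open \<Omega>\<close> fr \<open>L_subharmonic \<kappa> \<Omega> u\<close> that])
    show "u x \<le> c * f (x \<bullet> a - b)" if x: "x \<in> ball x0 R" for x
    proof -
      have "x \<in> \<Omega>" using x R(2) by blast
      \<comment> \<open>Both exponents are positive, so \<open>f\<close> is increasing and touching
        from above passes from \<open>?d\<close> to its affine majorant.\<close>
      then have "f (?d x) \<le> f (x \<bullet> a - b)"
        unfolding f_def using d_le[of x] d_pos[of x] \<beta>(1) by (intro add_mono powr_mono2) auto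
      then show ?thesis
        using le[OF \<open>x \<in> \<Omega>\<close>] c by (meson mult_left_mono less_imp_le order_trans)
    qed
    show "u x0 = c * f (x0 \<bullet> a - b)"
      using x0(2) d_eq by simp
    show "continuous_on (ball x0 R) (\<lambda>x. c * f (x \<bullet> a - b))"
      unfolding f_def using pos
      by (intro continuous_on_mult continuous_on_add continuous_on_powr affine_cont continuous_on_const) force+
    fix i :: "real ^ 'n"
    show "continuous_on (ball x0 R) (\<lambda>x. c * (f2 (x \<bullet> a - b) * (i \<bullet> a) * (i \<bullet> a)))"
      unfolding f2_def using pos
      by (intro continuous_on_mult continuous_on_add continuous_on_powr affine_cont continuous_on_const) force+
    fix y t assume y: "y + t *\<^sub>R i \<in> ball x0 R"
    show "((\<lambda>t. c * f ((y + t *\<^sub>R i) \<bullet> a - b)) has_real_derivative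
        c * (f1 ((y + t *\<^sub>R i) \<bullet> a - b) * (i \<bullet> a))) (at t)"
      by (intro DERIV_cmult DERIV_chain2[OF f1 line] pos y)
    show "((\<lambda>t. c * (f1 ((y + t *\<^sub>R i) \<bullet> a - b) * (i \<bullet> a))) has_real_derivative
        c * (f2 ((y + t *\<^sub>R i) \<bullet> a - b) * (i \<bullet> a) * (i \<bullet> a))) (at t)"
      by (intro DERIV_cmult DERIV_cmult_right DERIV_chain2[OF f2 line] pos y)
  qed
  \<comment> \<open>The Laplacian of a function of \<open>x \<bullet> a - b\<close> is its second
    derivative times the squared norm of \<open>a\<close>, which is 1.\<close>
  moreover have "(\<Sum>i\<in>Basis. c * (f2 (x0 \<bullet> a - b) * (i \<bullet> a) * (i \<bullet> a))) = c * f2 (?d x0)"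
  proof -
    have "(\<Sum>i\<in>Basis. (i \<bullet> a) * (i \<bullet> a)) = 1"
      using a euclidean_inner[of a a] by (simp add: norm_eq_1 inner_commute)
    then show ?thesis
      by (simp add: d_eq mult.assoc sum_distrib_left[symmetric])
  qed
  ultimately have "c * - f2 (?d x0) \<le> c * (\<kappa> * f (?d x0) / (?d x0)\<^sup>2)"
    by (simp add: x0(2) mult.left_commute)
  then have ineq: "- f2 (?d x0) \<le> \<kappa> * f (?d x0) / (?d x0)\<^sup>2"
    using c by (simp only: mult_le_cancel_left_pos)
  define P where "P = ?d x0 powr (\<beta> - 2)"
  define Q where "Q = ?d x0 powr (1 / 2 - 2)"
  have Q: "Q > 0"
    using d_pos[OF x0(1)] by (simp add: Q_def)
  have sq: "(?d x0)\<^sup>2 = ?d x0 powr 2"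
    using d_pos[OF x0(1)] by simp
  have "f (?d x0) / (?d x0)\<^sup>2 = P + Q"
    unfolding sq f_def P_def Q_def by (simp only: powr_diff add_divide_distrib)
  moreover have "- f2 (?d x0) = \<kappa> * P + Q / 4"
  proof -
    have "\<beta> - 1 - 1 = \<beta> - 2" "(1 / 2 - 1 - 1 :: real) = 1 / 2 - 2"
      by simp_all
    then have "f2 (?d x0) = \<beta> * ((\<beta> - 1) * P) + 1 / 2 * ((1 / 2 - 1) * Q)"
      unfolding f2_def P_def Q_def by (simp only:)
    then show ?thesis
      unfolding \<beta>(2)[symmetric] by (simp add: algebra_simps)
  qed
  ultimately have "\<kappa> * P + Q / 4 \<le> \<kappa> * (P + Q)"
    using ineq by (simp only: times_divide_eq_right[symmetric])
  \<comment> \<open>The terms in \<open>P\<close> cancel because \<open>t powr \<beta>\<close> is an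
    exact solution; only the square root contributes.\<close>
  then have "Q * (1 / 4 - \<kappa>) \<le> 0"
    by (simp add: algebra_simps)
  then show False
    using Q \<open>\<kappa> < 1 / 4\<close> by (simp add: mult_le_0_iff)
qed

end
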